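(* Let $q$ be a power of $2$, let $m$ be an odd positive integer, and let $a\in\mathbb{F}_q^*$. Let $f$ be a non-degenerate quadratic form over $\mathbb{F}_{q^m}$ which is equivalent to Type III. Let $D_f=\{x\in\mathbb{F}_{q^m}: f(x)=a\}$ and let $\mathcal{C}_{D_f}=\{(\mathrm{Tr}(xd))_{d\in D_f}: x\in\mathbb{F}_{q^m}\}$, a linear code over $\mathbb{F}_q$ of length $|D_f|$. Then $\mathcal{C}_{D_f}$ has the following weight hierarchy: $$d_r(\mathcal{C}_{D_f})=\begin{cases} q^{m-1}-q^{m-r-1}-q^{\frac{m-3}{2}}, & \text{if } 1\le r\le \frac{m-1}{2},\\ q^{m-1}-q^{m-r-1}-q^{m-r-2}, & \text{if } \frac{m+1}{2}\le r<m-1,\\ q^{m-1}-1, & \text{if } r=m-1,\\ q^{m-1}, & \text{if } r=m.\end{cases}$$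
   Context: $\mathrm{Tr}$ is the trace from $\mathbb{F}_{q^m}$ to $\mathbb{F}_q$. Generalized Hamming weights: for a $k$-dimensional linear code $\mathcal{C}\subseteq\mathbb{F}_q^n$ and an $\mathbb{F}_q$-subspace $H$ of $\mathcal{C}$, $\mathrm{supp}(H)=\{i: c_i\ne 0 \text{ for some } (c_1,\dots,c_n)\in H\}$. For $1\le r\le k$, $d_r(\mathcal{C})=\min\{|\mathrm{supp}(H)| : H \text{ an } r\text{-dimensional subspace of } \mathcal{C}\}$; the set $\{d_1(\mathcal C),\dots,d_k(\mathcal C)\}$ is the weight hierarchy of $\mathcal{C}$. Quadratic forms: fix a basis $\varepsilon_1,\dots,\varepsilon_m$ of $\mathbb{F}_{q^m}$ over $\mathbb{F}_q$ and identify $x=\sum x_i\varepsilon_i$ with $(x_1,\dots,x_m)\in\mathbb{F}_q^m$. A quadratic form over $\mathbb{F}_{q^m}$ is a map $f:\mathbb{F}_{q^m}\to\mathbb{F}_q$ of the form $f(x)=\sum_{1\le i\le j\le m}a_{ij}x_ix_j$ with $a_{ij}\in\mathbb{F}_q$. Put $\ker f=\{x\in\mathbb{F}_{q^m}: f(x+y)=f(y)\text{ for all }y\in\mathbb{F}_{q^m}\}$ (an $\mathbb{F}_q$-subspace). $f$ is non-degenerate if $\ker f=\{0\}$, and degenerate otherwise; $\mathrm{rank}\, f=m-\dim_{\mathbb{F}_q}\ker f$. Types: a quadratic form of rank $t$ is equivalent, under an invertible $\mathbb{F}_q$-linear change of coordinates, to exactly one of: Type I ($t$ even): $x_1x_2+x_3x_4+\cdots+x_{t-1}x_t$;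 Type II ($t$ even): $x_1x_2+\cdots+x_{t-3}x_{t-2}+\alpha x_{t-1}^2+x_{t-1}x_t+\alpha x_t^2$ with $\alpha\in\mathbb{F}_q\setminus\{x^2+x: x\in\mathbb{F}_q\}$; Type III ($t$ odd): $x_1x_2+\cdots+x_{t-2}x_{t-1}+x_t^2$. *)

theory Defs
  imports "HOL-Analysis.Analysis"
begin

text \<open>
  An extension of finite fields is given by two finite field types \<open>'k\<close> (the small field)
  and \<open>'K\<close> (the large field) together with an embedding \<open>\<iota> :: 'k \<Rightarrow> 'K\<close>.
\<close>

definition field_embedding :: "('k::field \<Rightarrow> 'K::field) \<Rightarrow> bool" where
  "field_embedding \<iota> \<longleftrightarrow> \<iota> 1 = 1 \<and> (\<forall>x y. \<iota> (x + y) = \<iota> x + \<iota> y) \<and> (\<forall>x y. \<iota> (x * y) = \<iota> x * \<iota> y)"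

definition ext_scale :: "('k::field \<Rightarrow> 'K::field) \<Rightarrow> 'k \<Rightarrow> 'K \<Rightarrow> 'K" where
  "ext_scale \<iota> c x = \<iota> c * x"

lemma vector_space_ext_scale:
  assumes "field_embedding \<iota>"
  shows "vector_space (ext_scale \<iota>)"
  using assms by unfold_locales (auto simp: field_embedding_def ext_scale_def algebra_simps)

abbreviation ext_dim :: "('k::field \<Rightarrow> 'K::field) \<Rightarrow> 'K set \<Rightarrow> nat" where
  "ext_dim \<iota> \<equiv> vector_space.dim (ext_scale \<iota>)"

definition ext_degree :: "('k::field \<Rightarrow> 'K::field) \<Rightarrow> nat" where
  "ext_degree \<iota> = ext_dim \<iota> UNIV"

text \<open>
  The sum of the conjugates lies in the range of the embedding; \<open>inv \<iota>\<close> reads it as an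
  element of the small field.
\<close>

definition field_trace :: "('k::{field,finite} \<Rightarrow> 'K::{field,finite}) \<Rightarrow> 'K \<Rightarrow> 'k" where
  "field_trace \<iota> x = inv \<iota> (\<Sum>i<ext_degree \<iota>. x ^ (CARD('k) ^ i))"

text \<open>Bases and coordinates are indexed by \<open>{1..m}\<close>.\<close>

definition is_ext_basis ::
    "('k::field \<Rightarrow> 'K::field) \<Rightarrow> nat \<Rightarrow> (nat \<Rightarrow> 'K) \<Rightarrow> bool" where
  "is_ext_basis \<iota> m \<epsilon> \<longleftrightarrow>
     inj_on \<epsilon> {1..m} \<and>
     \<not> module.dependent (ext_scale \<iota>) (\<epsilon> ` {1..m}) \<and>
     module.span (ext_scale \<iota>) (\<epsilon> ` {1..m}) = UNIV"

definition ext_coord ::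
    "('k::field \<Rightarrow> 'K::field) \<Rightarrow> nat \<Rightarrow> (nat \<Rightarrow> 'K) \<Rightarrow> 'K \<Rightarrow> nat \<Rightarrow> 'k" where
  "ext_coord \<iota> m \<epsilon> x i = module.representation (ext_scale \<iota>) (\<epsilon> ` {1..m}) x (\<epsilon> i)"

definition quadratic_form ::
    "('k::field \<Rightarrow> 'K::field) \<Rightarrow> nat \<Rightarrow> (nat \<Rightarrow> 'K) \<Rightarrow> ('K \<Rightarrow> 'k) \<Rightarrow> bool" where
  "quadratic_form \<iota> m \<epsilon> f \<longleftrightarrow>
     (\<exists>a :: nat \<Rightarrow> nat \<Rightarrow> 'k. \<forall>x.
        f x = (\<Sum>i\<in>{1..m}. \<Sum>j\<in>{i..m}. a i j * ext_coord \<iota> m \<epsilon> x i * ext_coord \<iota> m \<epsilon> x j))"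

definition qf_ker :: "('K::ab_group_add \<Rightarrow> 'k) \<Rightarrow> 'K set" where
  "qf_ker f = {x. \<forall>y. f (x + y) = f y}"

definition qf_nondegenerate :: "('K::ab_group_add \<Rightarrow> 'k) \<Rightarrow> bool" where
  "qf_nondegenerate f \<longleftrightarrow> qf_ker f = {0}"

definition qf_rank :: "('k::field \<Rightarrow> 'K::field) \<Rightarrow> nat \<Rightarrow> ('K \<Rightarrow> 'k) \<Rightarrow> nat" where
  "qf_rank \<iota> m f = m - ext_dim \<iota> (qf_ker f)"

text \<open>
  For odd \<open>t\<close>: \<open>x\<^sub>1 x\<^sub>2 + x\<^sub>3 x\<^sub>4 + \<dots> + x\<^sub>t\<^sub>-\<^sub>2 x\<^sub>t\<^sub>-\<^sub>1 + x\<^sub>t\<^sup>2\<close>, where \<open>x i\<close> is the \<open>i\<close>-th coordinate.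
\<close>

definition type_III_form :: "nat \<Rightarrow> (nat \<Rightarrow> 'k::field) \<Rightarrow> 'k" where
  "type_III_form t x = (\<Sum>i = 1..(t - 1) div 2. x (2 * i - 1) * x (2 * i)) + (x t)\<^sup>2"

definition qf_type_III ::
    "('k::field \<Rightarrow> 'K::field) \<Rightarrow> nat \<Rightarrow> (nat \<Rightarrow> 'K) \<Rightarrow> ('K \<Rightarrow> 'k) \<Rightarrow> bool" where
  "qf_type_III \<iota> m \<epsilon> f \<longleftrightarrow>
     odd (qf_rank \<iota> m f) \<and>
     (\<exists>L. Vector_Spaces.linear (ext_scale \<iota>) (ext_scale \<iota>) L \<and> bij L \<and>
        (\<forall>x. f (L x) = type_III_form (qf_rank \<iota> m f) (ext_coord \<iota> m \<epsilon> x)))"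

definition code_supp :: "('k::field ^ 'n) set \<Rightarrow> 'n set" where
  "code_supp H = {i. \<exists>c\<in>H. c $ i \<noteq> 0}"

definition gen_hamming_weight :: "nat \<Rightarrow> ('k::field ^ 'n) set \<Rightarrow> nat" where
  "gen_hamming_weight r C =
     Min {card (code_supp H) | H. vec.subspace H \<and> H \<subseteq> C \<and> vec.dim H = r}"

text \<open>
  The code of a defining set enumerated as \<open>d\<close>; the enumeration identifies the coordinate
  index type \<open>'n\<close> with the defining set.
\<close>

definition trace_code ::
    "('k::{field,finite} \<Rightarrow> 'K::{field,finite}) \<Rightarrow> ('n \<Rightarrow> 'K) \<Rightarrow> ('k ^ 'n) set" where
  "trace_code \<iota> d = range (\<lambda>x. \<chi> i. field_trace \<iota> (x * d i))"

end

theory Submission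
  imports Defs
begin

text \<open>
  Since \<open>x \<mapsto> (Tr (x d))\<^sub>d\<close> is injective, the \<open>r\<close>-dimensional subcodes correspond to the
  subspaces \<open>W\<close> of dimension \<open>m - r\<close> (trace-orthogonal complements), and \<open>d\<^sub>r\<close> is \<open>q ^ (m - 1)\<close> minus the
  largest number \<open>N\<close> of solutions of \<open>f w = a\<close> in such a \<open>W\<close>. Because \<open>f (t w) = t\<^sup>2 f w\<close> and every
  element is a square, all nonzero values are attained equally often on \<open>W\<close>, so the second moment of
  the level sizes determines \<open>(q N - |W|)\<^sup>2\<close>: it is \<open>|W| |R|\<close> if \<open>f\<close> vanishes on the radical \<open>R\<close> of \<open>W\<close>,
  and \<open>0\<close> otherwise. In the first case \<open>dim W + dim R \<le> m - 1\<close>, as \<open>W\<close> misses the radical of the whole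
  space, and \<open>dim R \<le> dim W - 2\<close> unless \<open>N = 0\<close>. The resulting bound is attained by an elliptic plane
  enlarged by hyperbolic planes and isotropic lines taken from the remaining coordinates.
\<close>

section \<open>Finite vector spaces and orthogonal complements\<close>

lemma card_eq_sum_fibres:
  fixes g :: "'a \<Rightarrow> 'b::finite"
  assumes "finite S"
  shows "card S = (\<Sum>c\<in>UNIV. card {x\<in>S. g x = c})"
proof -
  have "card S = (\<Sum>x\<in>S. 1)" by simp
  also have "\<dots> = (\<Sum>c\<in>UNIV. \<Sum>x\<in>{x\<in>S. g x = c}. 1)"
    by (rule sum.group[symmetric]) (use assms in auto)
  finally show ?thesis by simp
qed

text \<open>Translation by a difference of preimages carries one fibre onto another, so all fibres
  have the same size. Additivity is the right generality: on a radical the quadratic form is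
  additive but only semilinear.\<close>

lemma card_fibre_additive:
  fixes g :: "'v::ab_group_add \<Rightarrow> 'w::{ab_group_add,finite}"
  assumes fin: "finite S" and S: "\<And>x y. x \<in> S \<Longrightarrow> y \<in> S \<Longrightarrow> x + y \<in> S"
    "\<And>x y. x \<in> S \<Longrightarrow> y \<in> S \<Longrightarrow> x - y \<in> S"
    and g: "\<And>x y. x \<in> S \<Longrightarrow> y \<in> S \<Longrightarrow> g (x + y) = g x + g y"
    and surj: "\<And>c. \<exists>x\<in>S. g x = c"
  shows "CARD('w) * card {x\<in>S. g x = c} = card S"
proof -
  have "card {x\<in>S. g x = b} = card {x\<in>S. g x = c}" for b
  proof -
    obtain u v where uv: "u \<in> S" "g u = b" "v \<in> S" "g v = c" using surj by blast
    have gd: "g (x - y) = g x - g y" if "x \<in> S" "y \<in> S" for x y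
      using g[of "x - y" y] S that by (simp add: algebra_simps)
    show ?thesis
      by (rule bij_betw_same_card[of "\<lambda>x. x + (v - u)"],
          rule bij_betw_byWitness[where f' = "\<lambda>x. x + (u - v)"])
        (use uv S g gd in auto)
  qed
  then have "(\<Sum>b\<in>UNIV. card {x\<in>S. g x = b}) = (\<Sum>b\<in>(UNIV::'w set). card {x\<in>S. g x = c})"
    by (intro sum.cong) auto
  then show ?thesis using card_eq_sum_fibres[OF fin, of g] by simp
qed

lemma card_field_ge2: "CARD('a::{field,finite}) \<ge> 2"
proof -
  have "card {0, 1::'a} \<le> CARD('a)" by (rule card_mono) auto
  then show ?thesis by simp
qed

locale finite_vector_space = vector_space scale
  for scale :: "'k::{field,finite} \<Rightarrow> 'v::{ab_group_add,finite} \<Rightarrow> 'v" (infixr \<open>\<cdot>\<close> 75)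
begin

lemma card_span:
  assumes "independent B"
  shows "card (span B) = CARD('k) ^ card B"
proof -
  have "finite B" by simp
  then show ?thesis using assms
  proof (induction B)
    case (insert b B)
    have b: "b \<notin> span B" and IH: "card (span B) = CARD('k) ^ card B"
      using insert by (auto simp: independent_insert)
    have "bij_betw (\<lambda>(c, v). v + c \<cdot> b) (UNIV \<times> span B) (span (insert b B))"
      unfolding bij_betw_def
    proof
      show "inj_on (\<lambda>(c, v). v + c \<cdot> b) (UNIV \<times> span B)"
      proof (intro inj_onI, clarsimp)
        fix c v c' v' assume vs: "v \<in> span B" "v' \<in> span B" and eq: "v + c \<cdot> b = v' + c' \<cdot> b"
        have "(c - c') \<cdot> b = v' - v" using eq by (simp add: algebra_simps)
        then have "(c - c') \<cdot> b \<in> span B" using vs span_diff by simp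
        then have "c = c'" using span_scale[of "(c - c') \<cdot> b" B "inverse (c - c')"] b
          by (cases "c = c'") auto
        then show "c = c' \<and> v = v'" using eq by simp
      qed
      show "(\<lambda>(c, v). v + c \<cdot> b) ` (UNIV \<times> span B) = span (insert b B)"
      proof (intro equalityI subsetI)
        fix x assume "x \<in> (\<lambda>(c, v). v + c \<cdot> b) ` (UNIV \<times> span B)"
        then obtain c v where "x = v + c \<cdot> b" "v \<in> span B" by auto
        then have "x - c \<cdot> b \<in> span B" by simp
        then show "x \<in> span (insert b B)" by (auto simp: span_breakdown_eq)
      next
        fix x assume "x \<in> span (insert b B)"
        then obtain k where "x - k \<cdot> b \<in> span B" by (auto simp: span_breakdown_eq)
        then show "x \<in> (\<lambda>(c, v). v + c \<cdot> b) ` (UNIV \<times> span B)"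
          by (intro image_eqI[where x="(k, x - k \<cdot> b)"]) auto
      qed
    qed
    then show ?case using bij_betw_same_card IH insert by (fastforce simp: card_cartesian_product)
  qed simp
qed

lemma card_subspace:
  assumes "subspace S"
  shows "card S = CARD('k) ^ dim S"
proof -
  obtain B where B: "B \<subseteq> S" "independent B" "S \<subseteq> span B" "card B = dim S"
    by (rule basis_exists)
  then have "S = span B" using span_minimal assms by blast
  then show ?thesis using card_span B by simp
qed

lemma card_subspace_pos: "subspace S \<Longrightarrow> card S > 0"
  by (simp add: card_subspace)

text \<open>Dimensions are compared through cardinalities, since \<open>q ^ s\<close> determines
  \<open>s\<close> when \<open>q \<ge> 2\<close>.\<close>

lemma dim_eq_if_card_eq:
  assumes "subspace S" "card S = CARD('k) ^ s"
  shows "dim S = s"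
  using assms card_subspace card_field_ge2[where 'a='k] by (simp add: power_inject_exp)

lemma card_linear_fibre:
  assumes S: "subspace S" and add: "\<And>x y. g (x + y) = g x + g y"
    and sc: "\<And>c x. g (c \<cdot> x) = c * g x" and ne: "\<exists>x\<in>S. g x \<noteq> 0"
  shows "CARD('k) * card {x\<in>S. g x = c} = card S"
proof (rule card_fibre_additive)
  fix c
  obtain x where x: "x \<in> S" "g x \<noteq> 0" using ne by auto
  show "\<exists>x\<in>S. g x = c"
    by (rule bexI[where x="(c / g x) \<cdot> x"]) (use x sc S subspace_scale in auto)
qed (use S subspace_add subspace_diff add in auto)

definition bilin :: "('v \<Rightarrow> 'v \<Rightarrow> 'k) \<Rightarrow> bool" where
  "bilin \<beta> \<longleftrightarrow> (\<forall>x y z. \<beta> (x + y) z = \<beta> x z + \<beta> y z) \<and> (\<forall>c x z. \<beta> (c \<cdot> x) z = c * \<beta> x z)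
     \<and> (\<forall>x y. \<beta> x y = \<beta> y x)"

lemma bilinD:
  assumes "bilin \<beta>"
  shows bilin_add_left: "\<beta> (x + y) z = \<beta> x z + \<beta> y z"
    and bilin_scale_left: "\<beta> (c \<cdot> x) z = c * \<beta> x z"
    and bilin_sym: "\<beta> x y = \<beta> y x"
    and bilin_add_right: "\<beta> z (x + y) = \<beta> z x + \<beta> z y"
    and bilin_scale_right: "\<beta> z (c \<cdot> x) = c * \<beta> z x"
    and bilin_zero_left: "\<beta> 0 z = 0"
    and bilin_zero_right: "\<beta> z 0 = 0"
proof -
  show 1: "\<beta> (x + y) z = \<beta> x z + \<beta> y z" "\<beta> (c \<cdot> x) z = c * \<beta> x z" "\<beta> x y = \<beta> y x" for x y z c
    using assms unfolding bilin_def by blast+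
  show "\<beta> z (x + y) = \<beta> z x + \<beta> z y" "\<beta> z (c \<cdot> x) = c * \<beta> z x"
    using 1 by metis+
  show "\<beta> 0 z = 0" using 1(2)[of 0 0 z] by simp
  then show "\<beta> z 0 = 0" using 1(3) by metis
qed

definition perp :: "('v \<Rightarrow> 'v \<Rightarrow> 'k) \<Rightarrow> 'v set \<Rightarrow> 'v set" where
  "perp \<beta> S = {v. \<forall>y\<in>S. \<beta> v y = 0}"

lemma subspace_perp: "bilin \<beta> \<Longrightarrow> subspace (perp \<beta> S)"
  by (auto simp: subspace_def perp_def bilinD)

text \<open>Double counting of the orthogonal pairs in \<open>UNIV \<times> S\<close>.\<close>

lemma card_perp:
  assumes b: "bilin \<beta>" and S: "subspace S"
    and nd: "\<And>y. y \<in> S \<Longrightarrow> y \<noteq> 0 \<Longrightarrow> \<exists>v. \<beta> v y \<noteq> 0"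
  shows "card S * card (perp \<beta> S) = CARD('v)"
proof -
  let ?q = "CARD('k)" and ?n = "CARD('v)" and ?P = "perp \<beta> S"
  have q: "?q \<ge> 2" by (rule card_field_ge2)
  have "(\<Sum>y\<in>S. card {v\<in>UNIV. \<beta> v y = 0}) = (\<Sum>v\<in>UNIV. card {y\<in>S. \<beta> v y = 0})"
    by (rule sum_multicount_gen[symmetric]) auto
  then have eq: "(\<Sum>y\<in>S. ?q * card {v\<in>UNIV. \<beta> v y = 0}) = (\<Sum>v\<in>UNIV. ?q * card {y\<in>S. \<beta> v y = 0})"
    by (simp add: sum_distrib_left[symmetric])
  \<comment> \<open>Each inner count is the kernel of a linear functional: the whole space if the
    functional vanishes, a \<open>q\<close>-th part of it otherwise. The factor \<open>q\<close>
    avoids division.\<close>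
  have l: "?q * card {v\<in>UNIV. \<beta> v y = 0} = (if y = 0 then ?q * ?n else ?n)" if "y \<in> S" for y
  proof (cases "y = 0")
    case False
    then show ?thesis using card_linear_fibre[of UNIV "\<lambda>v. \<beta> v y" 0] nd that bilinD[OF b]
      by auto
  qed (simp add: bilinD[OF b])
  have r: "?q * card {y\<in>S. \<beta> v y = 0} = (if v \<in> ?P then ?q * card S else card S)" for v
  proof (cases "v \<in> ?P")
    case False
    then show ?thesis using card_linear_fibre[OF S, of "\<lambda>y. \<beta> v y" 0] bilinD[OF b]
      unfolding perp_def by auto
  next
    case True
    then have "{y\<in>S. \<beta> v y = 0} = S" by (auto simp: perp_def)
    then show ?thesis using True by simp
  qed
  have "0 \<in> S" using S subspace_0 by auto
  then have "(\<Sum>y\<in>S. ?q * card {v\<in>UNIV. \<beta> v y = 0}) = ?q * ?n + (card S - 1) * ?n"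
    using l by (simp add: sum.remove[where x=0] cong: sum.cong)
      (simp add: sum.If_cases card_Diff_singleton Int_absorb2 Diff_eq[symmetric])
  moreover have "(\<Sum>v\<in>UNIV. ?q * card {y\<in>S. \<beta> v y = 0})
      = card ?P * (?q * card S) + card (- ?P) * card S"
    unfolding r by (simp add: sum.If_cases)
  ultimately have "?q * ?n + (card S - 1) * ?n = card ?P * (?q * card S) + (?n - card ?P) * card S"
    using eq by (simp add: Compl_eq_Diff_UNIV card_Diff_subset)
  moreover have "card S \<ge> 1" using card_subspace_pos[OF S] by simp
  moreover have "card ?P \<le> ?n" by (rule card_mono) auto
  ultimately have "int ?q * int ?n + (int (card S) - 1) * int ?n
     = int (card ?P) * (int ?q * int (card S)) + (int ?n - int (card ?P)) * int (card S)"
    by (metis (no_types, opaque_lifting) of_nat_1 of_nat_add of_nat_diff of_nat_mult)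
  then have "(int ?q - 1) * int ?n = (int ?q - 1) * (int (card S) * int (card ?P))"
    by (simp add: algebra_simps)
  then have "int ?n = int (card S) * int (card ?P)" using q by simp
  then show ?thesis by (metis of_nat_eq_iff of_nat_mult)
qed

text \<open>A subspace lies in its double complement, and counting with \<open>card_perp\<close>
  twice makes the two equally large.\<close>

lemma perp_perp:
  assumes b: "bilin \<beta>" and S: "subspace S" and nd: "\<And>y. y \<noteq> 0 \<Longrightarrow> \<exists>v. \<beta> v y \<noteq> 0"
  shows "perp \<beta> (perp \<beta> S) = S"
proof -
  have "card S * card (perp \<beta> S) = card (perp \<beta> S) * card (perp \<beta> (perp \<beta> S))"
    using card_perp[OF b S] card_perp[OF b subspace_perp[OF b]] nd by simp
  then have "card S = card (perp \<beta> (perp \<beta> S))"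
    using card_subspace_pos[OF subspace_perp[OF b], of S] by auto
  moreover have "S \<subseteq> perp \<beta> (perp \<beta> S)" using bilin_sym[OF b] by (auto simp: perp_def)
  ultimately show ?thesis by (metis card_subset_eq finite)
qed

end

section \<open>Level sets of quadratic forms in characteristic two\<close>

text \<open>\<open>B\<close> is the polar form of \<open>f\<close>. In characteristic two it is
  alternating and does not determine \<open>f\<close>, which may be nonzero on the radical of
  \<open>B\<close>.\<close>

locale char2_quadratic_space = finite_vector_space scale
  for scale :: "'k::{field,finite} \<Rightarrow> 'v::{ab_group_add,finite} \<Rightarrow> 'v" (infixr \<open>\<cdot>\<close> 75) +
  fixes f :: "'v \<Rightarrow> 'k" and B :: "'v \<Rightarrow> 'v \<Rightarrow> 'k"
  assumes two: "(1::'k) + 1 = 0"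
    and f_add: "f (x + y) = f x + f y + B x y"
    and f_scale: "f (c \<cdot> x) = c\<^sup>2 * f x"
    and B: "bilin B"
begin

lemmas B_simps = bilinD[OF B]

lemma double_eq_0 [simp]: "x + x = (0::'k)"
proof -
  have "x + x = (1 + 1) * x" by (simp only: distrib_right mult_1_left)
  then show ?thesis using two by simp
qed

lemma add_eq_0_iff_char2: "x + y = 0 \<longleftrightarrow> x = (y::'k)"
  by (metis add_right_cancel double_eq_0)

lemma vec_double_eq_0: "x + x = (0::'v)"
proof -
  have "x + x = (1 + 1) \<cdot> x" by (simp only: scale_left_distrib scale_one)
  then show ?thesis using two by simp
qed

lemma f_0 [simp]: "f 0 = 0"
  using f_scale[of 0 0] by simp

lemma B_self [simp]: "B x x = 0"
  using f_add[of x x] by (simp add: vec_double_eq_0)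

lemma square_add: "(x + y)\<^sup>2 = x\<^sup>2 + (y::'k)\<^sup>2"
proof -
  have "(x + y)\<^sup>2 = x\<^sup>2 + y\<^sup>2 + (x * y + x * y)"
    by (simp add: power2_eq_square algebra_simps del: double_eq_0)
  then show ?thesis by simp
qed

text \<open>Squaring is additive in characteristic two with trivial kernel, hence injective, hence
  onto by finiteness.\<close>

lemma ex_sqrt: "\<exists>x. x\<^sup>2 = (c::'k)"
proof -
  have "inj (\<lambda>x::'k. x\<^sup>2)"
  proof (rule injI)
    fix x y :: 'k assume "x\<^sup>2 = y\<^sup>2"
    then have "(x + y)\<^sup>2 = 0" unfolding square_add by simp
    then show "x = y" by (simp add: add_eq_0_iff_char2)
  qed
  then have "surj (\<lambda>x::'k. x\<^sup>2)" by (rule finite_UNIV_inj_surj[OF finite])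
  then show ?thesis by (metis surjD)
qed

text \<open>The radical of \<open>B\<close> restricted to \<open>W\<close>, not of \<open>f\<close>:
  whether \<open>f\<close> vanishes on it is the main case distinction below.\<close>

definition rad :: "'v set \<Rightarrow> 'v set" where
  "rad W = W \<inter> perp B W"

lemma subspace_rad: "subspace W \<Longrightarrow> subspace (rad W)"
  unfolding rad_def by (intro subspace_inter subspace_perp B)

definition level :: "'v set \<Rightarrow> 'k \<Rightarrow> nat" where
  "level W a = card {w\<in>W. f w = a}"

text \<open>Scaling by a square root \<open>t\<close> of \<open>c / a\<close> multiplies the values
  of \<open>f\<close> by \<open>c / a\<close>.\<close>

lemma level_eq:
  assumes W: "subspace W" and a: "a \<noteq> 0" and c: "c \<noteq> 0"
  shows "level W c = level W a"
proof -
  obtain t where t: "t\<^sup>2 = c / a" using ex_sqrt by blast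
  then have t0: "t \<noteq> 0" using a c by auto
  have c_eq: "t\<^sup>2 * a = c" unfolding t using a by simp
  have "(inverse t)\<^sup>2 * (t\<^sup>2 * a) = (inverse t * t)\<^sup>2 * a"
    by (simp only: power_mult_distrib mult.assoc)
  then have a_eq: "(inverse t)\<^sup>2 * c = a" unfolding c_eq using t0 by simp
  have "bij_betw (\<lambda>w. t \<cdot> w) {w\<in>W. f w = a} {w\<in>W. f w = c}"
  proof (rule bij_betw_byWitness[where f'="\<lambda>w. inverse t \<cdot> w"])
    show "(\<lambda>w. t \<cdot> w) ` {w\<in>W. f w = a} \<subseteq> {w\<in>W. f w = c}"
      by (simp add: image_subset_iff f_scale c_eq subspace_scale[OF W])
    show "(\<lambda>w. inverse t \<cdot> w) ` {w\<in>W. f w = c} \<subseteq> {w\<in>W. f w = a}"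
      by (simp add: image_subset_iff f_scale a_eq subspace_scale[OF W] del: power_inverse)
  qed (use t0 in auto)
  from bij_betw_same_card[OF this] show ?thesis unfolding level_def by (rule sym)
qed

lemma level_0_add:
  assumes W: "subspace W" and a: "a \<noteq> 0"
  shows "level W 0 + (CARD('k) - 1) * level W a = card W"
proof -
  have "card W = (\<Sum>c\<in>UNIV. level W c)"
    unfolding level_def by (rule card_eq_sum_fibres) simp
  also have "\<dots> = level W 0 + (\<Sum>c\<in>UNIV-{0}. level W c)"
    by (simp add: sum.remove[where x=0])
  also have "(\<Sum>c\<in>UNIV-{0}. level W c) = (\<Sum>c\<in>UNIV-{0::'k}. level W a)"
    by (intro sum.cong refl) (metis DiffD2 level_eq[OF W a] singletonI)
  finally show ?thesis by (simp add: card_Diff_singleton)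
qed

text \<open>Both sides count the pairs in \<open>W\<close> on which \<open>f\<close> agrees. Writing
  the second entry as \<open>v + y\<close> turns \<open>f v = f (v + y)\<close> into
  \<open>B v y = f y\<close>, since signs do not matter in characteristic two.\<close>

lemma level_sum_squares:
  assumes W: "subspace W"
  shows "(\<Sum>c\<in>UNIV. (level W c)\<^sup>2) = (\<Sum>y\<in>W. card {v\<in>W. B v y = f y})"
proof -
  let ?S = "{(v, w). v \<in> W \<and> w \<in> W \<and> f v = f w}"
  have "card ?S = (\<Sum>c\<in>UNIV. card {p\<in>?S. f (fst p) = c})"
    by (rule card_eq_sum_fibres) (rule finite)
  also have "\<dots> = (\<Sum>c\<in>UNIV. (level W c)\<^sup>2)"
  proof (rule sum.cong[OF refl])
    fix c
    have "{p\<in>?S. f (fst p) = c} = {w\<in>W. f w = c} \<times> {w\<in>W. f w = c}"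
      by (intro set_eqI) (auto simp only: mem_Collect_eq mem_Times_iff split_beta)
    then show "card {p\<in>?S. f (fst p) = c} = (level W c)\<^sup>2"
      by (simp only: level_def card_cartesian_product power2_eq_square)
  qed
  finally have 1: "(\<Sum>c\<in>UNIV. (level W c)\<^sup>2) = card ?S" ..
  have f_iff: "f v = f (v + y) \<longleftrightarrow> B v y = f y" for v y
  proof -
    have "f v = f (v + y) \<longleftrightarrow> f y + B v y = 0"
      by (simp add: f_add add.assoc)
    then show ?thesis by (auto simp: add_eq_0_iff_char2)
  qed
  have "bij_betw (\<lambda>(y, v). (v, v + y)) (SIGMA y:W. {v\<in>W. B v y = f y}) ?S"
  proof (rule bij_betw_byWitness[where f'="\<lambda>(v, w). (w - v, v)"])
    show "(\<lambda>(y, v). (v, v + y)) ` (SIGMA y:W. {v\<in>W. B v y = f y}) \<subseteq> ?S"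
    proof (rule image_subsetI)
      fix p assume p: "p \<in> (SIGMA y:W. {v\<in>W. B v y = f y})"
      obtain y v where p_eq: "p = (y, v)" by (cases p)
      have "y \<in> W" "v \<in> W" "f v = f (v + y)" using p f_iff[of v y] unfolding p_eq by simp_all
      then show "(case p of (y, v) \<Rightarrow> (v, v + y)) \<in> ?S"
        unfolding p_eq using subspace_add[OF W] by simp
    qed
    show "(\<lambda>(v, w). (w - v, v)) ` ?S \<subseteq> (SIGMA y:W. {v\<in>W. B v y = f y})"
    proof (rule image_subsetI)
      fix p assume p: "p \<in> ?S"
      obtain v w where p_eq: "p = (v, w)" by (cases p)
      have vw: "v \<in> W" "w \<in> W" and "f v = f w" using p unfolding p_eq by simp_all
      then have "f v = f (v + (w - v))" by simp
      then have "B v (w - v) = f (w - v)" unfolding f_iff .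
      then show "(case p of (v, w) \<Rightarrow> (w - v, v)) \<in> (SIGMA y:W. {v\<in>W. B v y = f y})"
        unfolding p_eq using vw subspace_diff[OF W] by simp
    qed
    show "\<forall>p\<in>SIGMA y:W. {v\<in>W. B v y = f y}. (\<lambda>(v, w). (w - v, v)) ((\<lambda>(y, v). (v, v + y)) p) = p"
    proof
      show "(\<lambda>(v, w). (w - v, v)) ((\<lambda>(y, v). (v, v + y)) p) = p" for p :: "'v \<times> 'v"
        by (cases p) simp
    qed
    show "\<forall>p\<in>?S. (\<lambda>(y, v). (v, v + y)) ((\<lambda>(v, w). (w - v, v)) p) = p"
    proof
      show "(\<lambda>(y, v). (v, v + y)) ((\<lambda>(v, w). (w - v, v)) p) = p" for p :: "'v \<times> 'v"
        by (cases p) simp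
    qed
  qed
  then have "card (SIGMA y:W. {v\<in>W. B v y = f y}) = card ?S"
    by (rule bij_betw_same_card)
  moreover have "card (SIGMA y:W. {v\<in>W. B v y = f y}) = (\<Sum>y\<in>W. card {v\<in>W. B v y = f y})"
    by (rule card_SigmaI) simp_all
  ultimately show ?thesis using 1 by (simp only:)
qed

text \<open>For \<open>y\<close> outside the radical the equation \<open>B v y = f y\<close> has
  \<open>card W / q\<close> solutions; inside it there are \<open>card W\<close> or none, according
  to whether \<open>f y = 0\<close>. On the other side all nonzero levels equal
  \<open>level W a\<close>, and level 0 is what remains of \<open>W\<close>.\<close>

lemma second_moment:
  assumes W: "subspace W" and a: "a \<noteq> 0"
  shows "(int CARD('k) - 1) * (int CARD('k) * int (level W a) - int (card W))\<^sup>2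
    = int (card W) * (int CARD('k) * int (card {y\<in>rad W. f y = 0}) - int (card (rad W)))"
proof -
  let ?R0 = "{y\<in>rad W. f y = 0}"
  have term_eq: "CARD('k) * card {v\<in>W. B v y = f y} =
      (if y \<notin> rad W then card W else if f y = 0 then CARD('k) * card W else 0)" if y: "y \<in> W" for y
  proof (cases "y \<in> rad W")
    case True
    then have "B v y = 0" if "v \<in> W" for v
      using that by (auto simp: rad_def perp_def B_simps(3)[of v y])
    then have "{v\<in>W. B v y = f y} = (if f y = 0 then W else {})" by auto
    then show ?thesis using True by simp
  next
    case False
    then have "\<exists>v\<in>W. B v y \<noteq> 0" using y
      by (auto simp: rad_def perp_def B_simps(3)[of _ y])
    then have "CARD('k) * card {v\<in>W. B v y = f y} = card W"
      by (intro card_linear_fibre W) (simp_all add: B_simps)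
    then show ?thesis using False by simp
  qed
  have RW: "rad W \<subseteq> W" by (simp add: rad_def)
  have "CARD('k) * (\<Sum>c\<in>UNIV. (level W c)\<^sup>2) = (\<Sum>y\<in>W. CARD('k) * card {v\<in>W. B v y = f y})"
    by (simp add: level_sum_squares[OF W] sum_distrib_left)
  also have "\<dots> = (\<Sum>y\<in>W - rad W. card W) + (\<Sum>y\<in>rad W. if f y = 0 then CARD('k) * card W else 0)"
    unfolding sum.subset_diff[OF RW finite]
    by (intro arg_cong2[where f="(+)"] sum.cong refl) (use RW in \<open>simp_all add: term_eq subset_iff\<close>)
  also have "\<dots> = (card W - card (rad W)) * card W + card ?R0 * (CARD('k) * card W)"
    using RW by (simp add: card_Diff_subset sum.If_cases Int_def)
  finally have "int CARD('k) * int (\<Sum>c\<in>UNIV. (level W c)\<^sup>2)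
      = (int (card W) - int (card (rad W))) * int (card W) + int (card ?R0) * (int CARD('k) * int (card W))"
    using card_mono[OF _ RW] by (metis (no_types, lifting) finite of_nat_add of_nat_diff of_nat_mult)
  moreover have "int (\<Sum>c\<in>UNIV. (level W c)\<^sup>2)
      = (int (level W 0))\<^sup>2 + (int CARD('k) - 1) * (int (level W a))\<^sup>2"
  proof -
    have "(\<Sum>c\<in>UNIV. (level W c)\<^sup>2) = (level W 0)\<^sup>2 + (\<Sum>c\<in>UNIV-{0}. (level W c)\<^sup>2)"
      by (simp add: sum.remove[where x=0])
    also have "(\<Sum>c\<in>UNIV-{0}. (level W c)\<^sup>2) = (\<Sum>c\<in>UNIV-{0::'k}. (level W a)\<^sup>2)"
      by (intro sum.cong refl) (metis DiffD2 level_eq[OF W a] singletonI)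
    finally show ?thesis using card_field_ge2[where 'a='k] by (simp add: card_Diff_singleton of_nat_diff)
  qed
  moreover have "int (level W 0) = int (card W) - (int CARD('k) - 1) * int (level W a)"
    using level_0_add[OF W a] card_field_ge2[where 'a='k]
    by (metis (no_types, opaque_lifting) add_diff_cancel_right' le_trans of_nat_1 of_nat_add of_nat_diff of_nat_mult one_le_numeral)
  ultimately have *: "int CARD('k) * ((int (card W) - (int CARD('k) - 1) * int (level W a))\<^sup>2
      + (int CARD('k) - 1) * (int (level W a))\<^sup>2)
      = (int (card W) - int (card (rad W))) * int (card W) + int (card ?R0) * (int CARD('k) * int (card W))"
    by simp
  have "(int CARD('k) - 1) * (int CARD('k) * int (level W a) - int (card W))\<^sup>2
      = int CARD('k) * ((int (card W) - (int CARD('k) - 1) * int (level W a))\<^sup>2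
      + (int CARD('k) - 1) * (int (level W a))\<^sup>2) - (int (card W))\<^sup>2"
    by algebra
  also have "\<dots> = int (card W) * (int CARD('k) * int (card ?R0) - int (card (rad W)))"
    unfolding * by algebra
  finally show ?thesis .
qed

text \<open>Every radical vector is a zero of \<open>f\<close>, so the right side of
  \<open>second_moment\<close> also carries the factor \<open>q - 1\<close>, which cancels.\<close>

lemma level_isotropic_rad:
  assumes W: "subspace W" and a: "a \<noteq> 0" and R: "\<forall>y\<in>rad W. f y = 0"
  shows "(int CARD('k) * int (level W a) - int (card W))\<^sup>2 = int (card W) * int (card (rad W))"
proof -
  have "{y\<in>rad W. f y = 0} = rad W" using R by auto
  then have "(int CARD('k) - 1) * (int CARD('k) * int (level W a) - int (card W))\<^sup>2
      = (int CARD('k) - 1) * (int (card W) * int (card (rad W)))"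
    using second_moment[OF W a] by (simp add: algebra_simps)
  then show ?thesis using card_field_ge2[where 'a='k] by simp
qed

text \<open>On the radical \<open>f\<close> is additive, and scaling by square roots makes it onto.
  Its zeros there are a \<open>q\<close>-th part, so the right side of \<open>second_moment\<close>
  is 0.\<close>

lemma level_anisotropic_rad:
  assumes W: "subspace W" and a: "a \<noteq> 0" and R: "\<exists>y\<in>rad W. f y \<noteq> 0"
  shows "CARD('k) * level W a = card W"
proof -
  note sR = subspace_rad[OF W]
  have fa: "f (x + y) = f x + f y" if "x \<in> rad W" "y \<in> rad W" for x y
    using that by (simp add: f_add rad_def perp_def)
  have "CARD('k) * card {y\<in>rad W. f y = 0} = card (rad W)"
  proof (rule card_fibre_additive)
    fix c
    obtain y where y: "y \<in> rad W" "f y \<noteq> 0" using R by auto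
    obtain t where "t\<^sup>2 = c / f y" using ex_sqrt by blast
    then show "\<exists>x\<in>rad W. f x = c"
      by (intro bexI[of _ "t \<cdot> y"]) (use y sR in \<open>auto simp: f_scale subspace_scale\<close>)
  qed (use sR fa in \<open>auto simp: subspace_add subspace_diff\<close>)
  then have "int CARD('k) * int (card {y\<in>rad W. f y = 0}) - int (card (rad W)) = 0"
    by (metis diff_self of_nat_mult)
  then have "(int CARD('k) - 1) * (int CARD('k) * int (level W a) - int (card W))\<^sup>2 = 0"
    using second_moment[OF W a] by simp
  then have "int CARD('k) * int (level W a) = int (card W)" using card_field_ge2[where 'a='k] by simp
  then show ?thesis by (metis of_nat_eq_iff of_nat_mult)
qed

end

text \<open>An alternating form on an odd-dimensional space is degenerate, so nondegeneracy only
  excludes nonzero radical vectors with \<open>f x = 0\<close>. The vector \<open>n\<close> is a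
  radical vector normalized by \<open>f n = 1\<close>.\<close>

locale odd_quadratic_space = char2_quadratic_space scale f B
  for scale :: "'k::{field,finite} \<Rightarrow> 'v::{ab_group_add,finite} \<Rightarrow> 'v" (infixr \<open>\<cdot>\<close> 75)
    and f :: "'v \<Rightarrow> 'k" and B :: "'v \<Rightarrow> 'v \<Rightarrow> 'k" +
  fixes M :: nat and n :: 'v
  assumes card_V: "CARD('v) = CARD('k) ^ (2 * M + 1)"
    and nondegenerate: "f x = 0 \<Longrightarrow> (\<And>y. B x y = 0) \<Longrightarrow> x = 0"
    and f_n: "f n = 1"
    and B_n [simp]: "B n y = 0"
begin

section \<open>Level sizes of subspaces in odd dimension: upper bounds\<close>

lemma level_UNIV:
  assumes "a \<noteq> 0"
  shows "level UNIV a = CARD('k) ^ (2 * M)"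
proof -
  have "CARD('k) * level UNIV a = card (UNIV :: 'v set)"
  proof (rule level_anisotropic_rad[OF subspace_UNIV assms])
    have "n \<in> rad UNIV" by (simp add: rad_def perp_def)
    moreover have "f n \<noteq> 0" by (simp add: f_n)
    ultimately show "\<exists>y\<in>rad UNIV. f y \<noteq> 0" by blast
  qed
  then have "CARD('k) * level UNIV a = CARD('k) * CARD('k) ^ (2 * M)"
    unfolding card_V by (simp only: power_add power_one_right mult.commute)
  then show ?thesis by simp
qed

text \<open>\<open>W\<close> and \<open>n\<close> both lie in the complement of
  \<open>rad W\<close>, and \<open>n\<close> is not in \<open>W\<close>, where it would be a radical
  vector with nonzero \<open>f\<close>. So \<open>W\<close> is strictly smaller than that
  complement, which has dimension \<open>2 * M + 1 - dim (rad W)\<close>.\<close>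

lemma dim_rad_le_codim:
  assumes W: "subspace W" and R: "\<forall>y\<in>rad W. f y = 0"
  shows "dim W + dim (rad W) \<le> 2 * M"
proof -
  let ?P = "perp B (rad W)"
  have "n \<notin> W" using R f_n by (auto simp: rad_def perp_def)
  moreover have "n \<in> ?P" by (simp add: perp_def)
  moreover have "W \<subseteq> ?P" by (auto simp: perp_def rad_def B_simps(3)[of _ y for y])
  ultimately have "W \<subset> ?P" by auto
  then have "CARD('k) ^ dim W < CARD('k) ^ dim ?P"
    using psubset_card_mono[of ?P W] card_subspace[OF W] card_subspace[OF subspace_perp[OF B]] by simp
  then have 1: "dim W < dim ?P" using card_field_ge2[where 'a='k] by (simp add: power_strict_increasing_iff)
  \<comment> \<open>Although \<open>B\<close> is degenerate, no nonzero vector of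
    \<open>rad W\<close> is orthogonal to the whole space, because \<open>f\<close> vanishes on
    \<open>rad W\<close>.\<close>
  have "card (rad W) * card ?P = CARD('v)"
    by (rule card_perp[OF B subspace_rad[OF W]]) (use R nondegenerate B_simps(3) in metis)
  then have "CARD('k) ^ (dim (rad W) + dim ?P) = CARD('k) ^ (2 * M + 1)"
    by (simp add: card_V card_subspace subspace_rad W subspace_perp B power_add)
  then have "dim (rad W) + dim ?P = 2 * M + 1"
    using card_field_ge2[where 'a='k] by (simp add: power_inject_exp del: power_Suc)
  then show ?thesis using 1 by simp
qed

text \<open>The nondegenerate quotient \<open>W / rad W\<close> is alternating, so it cannot be one-dimensional.\<close>

lemma dim_rad_gap:
  assumes W: "subspace W" and ne: "rad W \<noteq> W"
  shows "dim (rad W) + 2 \<le> dim W"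
proof -
  have RW: "rad W \<subseteq> W" by (simp add: rad_def)
  obtain w where w: "w \<in> W" "w \<notin> rad W" using RW ne by auto
  then obtain y where y: "y \<in> W" "B w y \<noteq> 0" by (auto simp: rad_def perp_def)
  note sR = subspace_rad[OF W]
  let ?g = "\<lambda>(c, r). r + c \<cdot> w"
  have inj: "inj_on ?g (UNIV \<times> rad W)"
  proof (intro inj_onI, clarify)
    fix c r c' r' assume r: "r \<in> rad W" "r' \<in> rad W" and eq: "r + c \<cdot> w = r' + c' \<cdot> w"
    have "B (r + c \<cdot> w) y = B (r' + c' \<cdot> w) y" using eq by simp
    then have "c * B w y = c' * B w y"
      using r y unfolding bilin_add_left[OF B] bilin_scale_left[OF B] by (simp add: rad_def perp_def)
    then show "c = c' \<and> r = r'" using y eq by simp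
  qed
  \<comment> \<open>The span of \<open>rad W\<close> and \<open>w\<close> is orthogonal to
    \<open>w\<close>, as \<open>B\<close> is alternating, whereas \<open>y\<close> is not; hence it
    is a proper subspace of \<open>W\<close>.\<close>
  have "B w z = 0" if z: "z \<in> ?g ` (UNIV \<times> rad W)" for z
  proof -
    obtain c r where z_eq: "z = r + c \<cdot> w" and "r \<in> rad W" using z by auto
    then have "B r w = 0" using w by (simp add: rad_def perp_def)
    then have "B w r = 0" using bilin_sym[OF B] by metis
    then show ?thesis unfolding z_eq by (simp add: bilin_add_right[OF B] bilin_scale_right[OF B])
  qed
  then have "?g ` (UNIV \<times> rad W) \<noteq> W" using y by blast
  moreover have "?g ` (UNIV \<times> rad W) \<subseteq> W"
    using RW w W by (auto intro!: subspace_add subspace_scale)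
  ultimately have "card (?g ` (UNIV \<times> rad W)) < card W"
    by (simp add: psubset_card_mono psubset_eq)
  then have "CARD('k) ^ (dim (rad W) + 1) < CARD('k) ^ dim W"
    using card_image[OF inj] by (simp add: card_cartesian_product card_subspace W sR)
  then show ?thesis
    using card_field_ge2[where 'a='k] by (simp add: power_strict_increasing_iff del: power_Suc)
qed

text \<open>If \<open>f\<close> is nonzero on the radical, the level is exactly
  \<open>q ^ (s - 1)\<close> with \<open>s = dim W\<close>. If \<open>f\<close> vanishes on the
  radical and \<open>rad W \<noteq> W\<close>, the two dimension bounds combine to
  \<open>s + dim (rad W) \<le> 2 * k\<close> with \<open>k = min M (s - 1)\<close>, and a square
  root bounds the excess.\<close>

lemma level_le:
  assumes W: "subspace W" and a: "a \<noteq> 0" and s: "dim W \<ge> 2"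
  shows "level W a \<le> CARD('k) ^ (dim W - 1) + CARD('k) ^ (min M (dim W - 1) - 1)"
proof -
  define s where "s = dim W"
  define k where "k = min M (s - 1)"
  define Q where "Q = int CARD('k)"
  have Q: "Q \<ge> 2" using card_field_ge2[where 'a='k] unfolding Q_def by linarith
  have cW: "card W = CARD('k) ^ s" unfolding s_def by (rule card_subspace[OF W])
  have qs: "CARD('k) ^ s = CARD('k) * CARD('k) ^ (s - 1)"
    using s unfolding s_def by (cases "dim W") auto
  have "level W a \<le> CARD('k) ^ (s - 1) + CARD('k) ^ (k - 1)"
  proof (cases "\<exists>y\<in>rad W. f y \<noteq> 0")
    case True
    then have "CARD('k) * level W a = CARD('k) * CARD('k) ^ (s - 1)"
      using level_anisotropic_rad[OF W a] unfolding cW qs by blast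
    then have "level W a = CARD('k) ^ (s - 1)" by simp
    then show ?thesis by linarith
  next
    case False
    then have R: "\<forall>y\<in>rad W. f y = 0" by auto
    show ?thesis
    proof (cases "rad W = W")
      case True
      then have "{w\<in>W. f w = a} = {}" using R a by auto
      then have "level W a = 0" by (simp only: level_def card.empty)
      then show ?thesis by simp
    next
      case False
      have s2: "s \<ge> 2" using s unfolding s_def .
      have "s + dim (rad W) \<le> 2 * M" "s + dim (rad W) \<le> 2 * (s - 1)"
        using dim_rad_le_codim[OF W R] dim_rad_gap[OF W False] unfolding s_def by linarith+
      then have sum_le: "s + dim (rad W) \<le> 2 * k" by (simp add: k_def min_def)
      then have k1: "k \<ge> 1" using s2 by linarith
      have "(Q * int (level W a) - Q ^ s)\<^sup>2 = Q ^ (s + dim (rad W))"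
        using level_isotropic_rad[OF W a R]
        unfolding cW card_subspace[OF subspace_rad[OF W]] Q_def of_nat_power power_add .
      also have "\<dots> \<le> Q ^ (2 * k)" using sum_le Q by (intro power_increasing) auto
      also have "\<dots> = (Q ^ k)\<^sup>2" by (rule power_even_eq)
      finally have "Q * int (level W a) - Q ^ s \<le> Q ^ k"
        by (rule power2_le_imp_le) (use Q in simp)
      moreover have "Q ^ s = Q * Q ^ (s - 1)" using s unfolding s_def by (cases "dim W") auto
      moreover have "Q ^ k = Q * Q ^ (k - 1)" using k1 by (metis Suc_diff_le One_nat_def diff_Suc_1 le_add_diff_inverse plus_1_eq_Suc power_Suc)
      ultimately have "Q * int (level W a) \<le> Q * (Q ^ (s - 1) + Q ^ (k - 1))"
        by (simp only: distrib_left diff_le_eq add.commute)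
      then have "int (level W a) \<le> Q ^ (s - 1) + Q ^ (k - 1)" using Q by simp
      then have "int (level W a) \<le> int (CARD('k) ^ (s - 1) + CARD('k) ^ (k - 1))"
        by (simp add: Q_def)
      then show ?thesis by (simp only: of_nat_le_iff)
    qed
  qed
  then show ?thesis unfolding k_def s_def .
qed

text \<open>The zero vector uses up one element of the line, and the other \<open>q - 1\<close>
  elements leave room for at most one in each of the \<open>q - 1\<close> equal levels.\<close>

lemma level_line_le:
  assumes W: "subspace W" and a: "a \<noteq> 0" and s: "dim W = 1"
  shows "level W a \<le> 1"
proof -
  have "0 \<in> {w\<in>W. f w = 0}" using W subspace_0 by simp
  then have "level W 0 \<ge> 1" unfolding level_def by (metis One_nat_def Suc_leI card_gt_0_iff empty_iff finite)
  moreover have "card W = CARD('k)" using card_subspace[OF W] s by simp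
  ultimately have "(CARD('k) - 1) * level W a \<le> (CARD('k) - 1) * 1"
    using level_0_add[OF W a] by linarith
  then show ?thesis unfolding mult_le_cancel1 using card_field_ge2[where 'a='k] by simp
qed

lemma level_trivial:
  assumes W: "subspace W" and a: "a \<noteq> 0" and s: "dim W = 0"
  shows "level W a = 0"
proof -
  have "card W = 1" using card_subspace[OF W] s by simp
  then have "W = {0}" using W subspace_0 by (metis card_1_singletonE singletonD)
  then have "{w\<in>W. f w = a} = {}" using a by auto
  then show ?thesis by (simp add: level_def)
qed

lemma dim_less:
  assumes W: "subspace W" and ne: "W \<noteq> UNIV"
  shows "dim W \<le> 2 * M"
proof -
  have "card W < CARD('v)" using ne by (simp add: psubset_card_mono psubset_eq)
  then have "CARD('k) ^ dim W < CARD('k) ^ (2 * M + 1)" using card_subspace[OF W] card_V by simp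
  then show ?thesis using card_field_ge2[where 'a='k] by (simp add: power_strict_increasing_iff del: power_Suc)
qed

text \<open>Strictness against \<open>level_UNIV\<close> means that the defining set lies in no
  proper subspace, which gives the code its full dimension.\<close>

lemma level_proper_less:
  assumes W: "subspace W" and a: "a \<noteq> 0" and ne: "W \<noteq> UNIV"
  shows "level W a < CARD('k) ^ (2 * M)"
proof -
  note q2 = card_field_ge2[where 'a='k]
  have d: "dim W \<le> 2 * M" by (rule dim_less[OF W ne])
  consider "dim W = 0" | "dim W = 1" | "dim W \<ge> 2" by linarith
  then show ?thesis
  proof cases
    case 1
    then show ?thesis using level_trivial[OF W a] q2 by simp
  next
    case 2
    then have "CARD('k) ^ 0 < CARD('k) ^ (2 * M)" using d q2 by (intro power_strict_increasing) auto
    then show ?thesis using level_line_le[OF W a 2] by simp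
  next
    case 3
    \<comment> \<open>\<open>M'\<close> is \<open>2 * M - 1\<close>. The first exponent of
      \<open>level_le\<close> is at most \<open>M'\<close> and the second is below it, so the bound
      stays under \<open>2 * q ^ M'\<close>.\<close>
    then obtain M' where M': "2 * M = Suc M'" "M - 1 < M'" using d by (cases M) auto
    have "level W a \<le> CARD('k) ^ (dim W - 1) + CARD('k) ^ (min M (dim W - 1) - 1)"
      by (rule level_le[OF W a 3])
    also have "CARD('k) ^ (dim W - 1) \<le> CARD('k) ^ M'" using d M' q2 by (intro power_increasing) auto
    also have "CARD('k) ^ (min M (dim W - 1) - 1) < CARD('k) ^ M'"
      using M' q2 by (intro power_strict_increasing) auto
    also have "CARD('k) ^ M' + CARD('k) ^ M' = 2 * CARD('k) ^ M'" by simp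
    also have "\<dots> \<le> CARD('k) ^ (2 * M)" unfolding M'(1) using q2 by simp
    finally show ?thesis by simp
  qed
qed

end

section \<open>Subspaces with many solutions\<close>

context char2_quadratic_space
begin

text \<open>The sum of \<open>W\<close> and the line of \<open>u\<close>, written as the image of a
  parametrization so that solutions can be counted by coordinates.\<close>

definition extend :: "'v set \<Rightarrow> 'v \<Rightarrow> 'v set" where
  "extend W u = (\<lambda>(w, x). w + x \<cdot> u) ` (W \<times> UNIV)"

lemma extendE:
  assumes "z \<in> extend W u"
  obtains w x where "z = w + x \<cdot> u" "w \<in> W"
  using assms by (auto simp: extend_def)

lemma extendI: "w \<in> W \<Longrightarrow> w + x \<cdot> u \<in> extend W u"
  by (auto simp: extend_def)

lemma subspace_extend:
  assumes "subspace W"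
  shows "subspace (extend W u)"
proof (rule subspaceI)
  show "0 \<in> extend W u" using extendI[of 0 W 0 u] subspace_0[OF assms] by simp
next
  fix y z assume "y \<in> extend W u" "z \<in> extend W u"
  then obtain w x w' x' where "y = w + x \<cdot> u" "w \<in> W" "z = w' + x' \<cdot> u" "w' \<in> W"
    by (metis extendE)
  then show "y + z \<in> extend W u"
    using extendI[of "w + w'" W "x + x'" u] subspace_add[OF assms] by (simp add: algebra_simps)
next
  fix c z assume "z \<in> extend W u"
  then obtain w x where "z = w + x \<cdot> u" "w \<in> W" by (metis extendE)
  then show "c \<cdot> z \<in> extend W u"
    using extendI[of "c \<cdot> w" W "c * x" u] subspace_scale[OF assms] by (simp add: algebra_simps)
qed

lemma inj_extend:
  assumes W: "subspace W" and u: "u \<notin> W"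
  shows "inj_on (\<lambda>(w, x). w + x \<cdot> u) (W \<times> UNIV)"
proof (intro inj_onI, clarify)
  fix w x w' x' assume w: "w \<in> W" "w' \<in> W" and eq: "w + x \<cdot> u = w' + x' \<cdot> u"
  have "(x - x') \<cdot> u = w' - w" using eq by (simp add: algebra_simps)
  then have "(x - x') \<cdot> u \<in> W" using subspace_diff[OF W] w by simp
  then have "inverse (x - x') \<cdot> ((x - x') \<cdot> u) \<in> W" by (rule subspace_scale[OF W])
  then have "x = x'" using u by (cases "x = x'") auto
  then show "w = w' \<and> x = x'" using eq by simp
qed

lemma card_extend:
  assumes "subspace W" "u \<notin> W"
  shows "card (extend W u) = CARD('k) * card W"
  unfolding extend_def card_image[OF inj_extend[OF assms]]
  by (simp add: card_cartesian_product)

text \<open>Slices by the coefficient of \<open>u\<close> or by the component in \<open>W\<close>: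
  the first suits directions along which \<open>f\<close> is constant, the second those along which
  it is affine.\<close>

lemma card_extend_Collect:
  assumes "subspace W" "u \<notin> W"
  shows "card {z\<in>extend W u. P z} = (\<Sum>x\<in>UNIV. card {w\<in>W. P (w + x \<cdot> u)})"
    and "card {z\<in>extend W u. P z} = (\<Sum>w\<in>W. card {x. P (w + x \<cdot> u)})"
proof -
  let ?g = "\<lambda>(w, x). w + x \<cdot> u"
  let ?S = "SIGMA w:W. {x. P (w + x \<cdot> u)}"
  let ?T = "SIGMA x:UNIV. {w\<in>W. P (w + x \<cdot> u)}"
  have "{z\<in>extend W u. P z} = ?g ` ?S" by (auto simp: extend_def)
  moreover have "inj_on ?g ?S" by (rule inj_on_subset[OF inj_extend[OF assms]]) auto
  ultimately have S: "card {z\<in>extend W u. P z} = card ?S" by (simp only: card_image)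
  also have "?S = prod.swap ` ?T" by auto
  also have "card (prod.swap ` ?T) = card ?T" by (rule card_image) simp
  also have "card ?T = (\<Sum>x\<in>UNIV. card {w\<in>W. P (w + x \<cdot> u)})" by (rule card_SigmaI) simp_all
  finally show "card {z\<in>extend W u. P z} = (\<Sum>x\<in>UNIV. card {w\<in>W. P (w + x \<cdot> u)})" .
  show "card {z\<in>extend W u. P z} = (\<Sum>w\<in>W. card {x. P (w + x \<cdot> u)})"
    unfolding S by (rule card_SigmaI) simp_all
qed

lemma notin_if_dual_vector:
  assumes "\<And>w. w \<in> W \<Longrightarrow> B w v = 0" "B u v = 1"
  shows "u \<notin> W"
  using assms by fastforce

text \<open>Adding multiples of \<open>u\<close> does not change \<open>f\<close> on
  \<open>W\<close>, so each of the \<open>q\<close> slices repeats the count for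
  \<open>W\<close>.\<close>

lemma level_extend_isotropic:
  assumes W: "subspace W" and perp: "\<And>w. w \<in> W \<Longrightarrow> B w u = 0"
    and u: "u \<notin> W" "f u = 0"
  shows "level (extend W u) a = CARD('k) * level W a"
proof -
  have "level (extend W u) a = (\<Sum>x\<in>UNIV. card {w\<in>W. f (w + x \<cdot> u) = a})"
    unfolding level_def by (rule card_extend_Collect[OF W u(1)])
  also have "\<dots> = (\<Sum>x\<in>(UNIV::'k set). level W a)"
  proof (rule sum.cong[OF refl])
    fix x
    have "f (w + x \<cdot> u) = f w" if "w \<in> W" for w
      using perp[OF that] by (simp add: f_add f_scale u bilin_scale_right[OF B])
    then have "{w\<in>W. f (w + x \<cdot> u) = a} = {w\<in>W. f w = a}" by auto
    then show "card {w\<in>W. f (w + x \<cdot> u) = a} = level W a" by (simp only: level_def)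
  qed
  finally show ?thesis by simp
qed

text \<open>The slice with \<open>v\<close>-coefficient 0 is the isotropic case. For a coefficient
  \<open>y \<noteq> 0\<close>, \<open>f\<close> has the form \<open>f w + y * x\<close> and each
  \<open>w\<close> admits exactly one \<open>x\<close>.\<close>

lemma level_extend_hyperbolic:
  assumes W: "subspace W" and perp: "\<And>w. w \<in> W \<Longrightarrow> B w u = 0" "\<And>w. w \<in> W \<Longrightarrow> B w v = 0"
    and uv: "f u = 0" "f v = 0" "B u v = 1"
  shows "level (extend (extend W u) v) a = CARD('k) * level W a + (CARD('k) - 1) * card W"
proof -
  have u: "u \<notin> W" by (rule notin_if_dual_vector[OF perp(2) uv(3)])
  have vu: "B v u = 1" using uv(3) bilin_sym[OF B] by metis
  have Bv: "B (w + x \<cdot> u) v = x" if "w \<in> W" for w x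
    using perp(2)[OF that] by (simp add: bilin_add_left[OF B] bilin_scale_left[OF B] uv)
  have "B z u = 0" if "z \<in> extend W u" for z
    using that perp(1) by (auto elim!: extendE simp: bilin_add_left[OF B] bilin_scale_left[OF B])
  then have v: "v \<notin> extend W u" by (rule notin_if_dual_vector[OF _ vu])
  have f_eq: "f (z + y \<cdot> v) = f z + y * B z v" for z y
    by (simp add: f_add f_scale uv bilin_scale_right[OF B])
  have y: "card {z\<in>extend W u. f (z + y \<cdot> v) = a} = card W" if y0: "y \<noteq> 0" for y
  proof -
    have "card {x. f (w + x \<cdot> u + y \<cdot> v) = a} = 1" if w: "w \<in> W" for w
    proof -
      have "f (w + x \<cdot> u + y \<cdot> v) = a \<longleftrightarrow> x = (a - f w) / y" for x
      proof -
        have "f (w + x \<cdot> u) = f w"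
          using perp(1)[OF w] by (simp add: f_add f_scale uv bilin_scale_right[OF B])
        then have "f (w + x \<cdot> u + y \<cdot> v) = f w + y * x"
          unfolding f_eq Bv[OF w] by simp
        then show ?thesis using y0 by (auto simp: field_simps)
      qed
      then have "{x. f (w + x \<cdot> u + y \<cdot> v) = a} = {(a - f w) / y}" by blast
      then show ?thesis by (simp only: card.insert card.empty finite.emptyI empty_iff if_False not_False_eq_True)
    qed
    then have "(\<Sum>w\<in>W. card {x. f (w + x \<cdot> u + y \<cdot> v) = a}) = card W"
      by (simp cong: sum.cong)
    then show ?thesis unfolding card_extend_Collect(2)[OF W u] .
  qed
  have "level (extend (extend W u) v) a = (\<Sum>y\<in>UNIV. card {z\<in>extend W u. f (z + y \<cdot> v) = a})"
    unfolding level_def by (rule card_extend_Collect[OF subspace_extend[OF W] v])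
  also have "\<dots> = card {z\<in>extend W u. f (z + 0 \<cdot> v) = a}
      + (\<Sum>y\<in>UNIV-{0}. card {z\<in>extend W u. f (z + y \<cdot> v) = a})"
    by (rule sum.remove) simp_all
  also have "(\<Sum>y\<in>UNIV-{0}. card {z\<in>extend W u. f (z + y \<cdot> v) = a}) = (\<Sum>y\<in>UNIV-{0::'k}. card W)"
    by (rule sum.cong[OF refl], rule y) simp
  also have "card {z\<in>extend W u. f (z + 0 \<cdot> v) = a} = CARD('k) * level W a"
    using level_extend_isotropic[OF W perp(1) u uv(1), of a] by (simp add: level_def)
  finally show ?thesis by (simp add: card_Diff_singleton)
qed

text \<open>Coefficients of an anisotropic binary form: \<open>t \<mapsto> t + 1/t\<close> cannot be onto on nonzero elements.\<close>

lemma exists_anisotropic_coeff: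
  "\<exists>b::'k. b \<noteq> 0 \<and> (\<forall>x y. b * (x + y)\<^sup>2 + x * y = 0 \<longrightarrow> x = 0 \<and> y = 0)"
proof -
  let ?h = "\<lambda>t::'k. t + 1 / t"
  have "card (?h ` (UNIV - {0})) \<le> card (UNIV - {0::'k})" by (rule card_image_le) simp
  also have "\<dots> < CARD('k)" by (rule psubset_card_mono) auto
  finally have "?h ` (UNIV - {0}) \<noteq> UNIV" by auto
  then obtain g where "g \<notin> ?h ` (UNIV - {0})" by auto
  then have g: "g \<noteq> t + 1 / t" if "t \<noteq> 0" for t using that by auto
  \<comment> \<open>\<open>t = 1\<close> already gives the value \<open>1 + 1 = 0\<close>, so the
    missed value \<open>g\<close> is invertible; the coefficient will be
    \<open>1 / g\<close>.\<close>
  have "g \<noteq> 0" using g[of 1] two by simp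
  have "x = 0 \<and> y = 0" if eq: "1 / g * (x + y)\<^sup>2 + x * y = 0" for x y
  proof -
    have eq': "(x + y)\<^sup>2 = g * (x * y)"
      using eq \<open>g \<noteq> 0\<close> by (simp add: add_eq_0_iff_char2 field_simps)
    show ?thesis
    proof (cases "x = 0 \<or> y = 0")
      case True
      then have "(x + y)\<^sup>2 = 0" using eq' by auto
      then show ?thesis using True by auto
    next
      case False
      have "x / y + 1 / (x / y) = (x\<^sup>2 + y\<^sup>2) / (x * y)"
        using False by (simp add: field_simps power2_eq_square)
      also have "\<dots> = g" unfolding square_add[symmetric] eq' using False by simp
      finally show ?thesis using g[of "x / y"] False by simp
    qed
  qed
  moreover have "1 / g \<noteq> 0" using \<open>g \<noteq> 0\<close> by simp
  ultimately show ?thesis by blast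
qed

end

text \<open>The vectors \<open>e i\<close>, \<open>e' i\<close> are the hyperbolic pairs of the
  coordinates \<open>x_(2i-1)\<close>, \<open>x_(2i)\<close>, and \<open>n\<close> belongs to the
  last coordinate of the normal form.\<close>

locale type_III_space = odd_quadratic_space scale f B M n
  for scale :: "'k::{field,finite} \<Rightarrow> 'v::{ab_group_add,finite} \<Rightarrow> 'v" (infixr \<open>\<cdot>\<close> 75)
    and f :: "'v \<Rightarrow> 'k" and B :: "'v \<Rightarrow> 'v \<Rightarrow> 'k" and M :: nat and n :: 'v +
  fixes e e' :: "nat \<Rightarrow> 'v"
  assumes f_e: "i \<in> {1..M} \<Longrightarrow> f (e i) = 0" "i \<in> {1..M} \<Longrightarrow> f (e' i) = 0"
    and B_e: "i \<in> {1..M} \<Longrightarrow> j \<in> {1..M} \<Longrightarrow> B (e i) (e j) = 0"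
      "i \<in> {1..M} \<Longrightarrow> j \<in> {1..M} \<Longrightarrow> B (e' i) (e' j) = 0"
      "i \<in> {1..M} \<Longrightarrow> j \<in> {1..M} \<Longrightarrow> B (e i) (e' j) = (if i = j then 1 else 0)"
begin

section \<open>Extremal subspaces built from hyperbolic pairs\<close>

lemma B_e': "i \<in> {1..M} \<Longrightarrow> j \<in> {1..M} \<Longrightarrow> B (e' i) (e j) = (if i = j then 1 else 0)"
  using B_e(3)[of j i] by (simp add: bilin_sym[OF B, of "e' i" "e j"])

text \<open>Shifting the first hyperbolic pair by a multiple of the radical vector \<open>n\<close>
  leaves \<open>B\<close> unchanged and makes both values of \<open>f\<close> equal to
  \<open>b\<close>. The resulting form \<open>b * (x + y)\<^sup>2 + x * y\<close> vanishes only at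
  0, so the other \<open>q\<^sup>2 - 1\<close> vectors are split equally over \<open>q - 1\<close>
  levels.\<close>

lemma exists_elliptic_plane:
  assumes a: "a \<noteq> 0" and M: "M \<ge> 1"
  shows "\<exists>W. subspace W \<and> card W = CARD('k)\<^sup>2 \<and> level W a = CARD('k) + 1
    \<and> (\<forall>w\<in>W. \<forall>i\<in>{1<..M}. B w (e i) = 0 \<and> B w (e' i) = 0)"
proof -
  obtain b :: 'k where b: "b \<noteq> 0" "\<And>x y. b * (x + y)\<^sup>2 + x * y = 0 \<Longrightarrow> x = 0 \<and> y = 0"
    using exists_anisotropic_coeff by blast
  obtain \<beta> where \<beta>: "\<beta>\<^sup>2 = b" using ex_sqrt by blast
  define p where "p = e 1 + \<beta> \<cdot> n"
  define p' where "p' = e' 1 + \<beta> \<cdot> n"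
  have Bn: "B y n = 0" for y using B_n[of y] bilin_sym[OF B] by metis
  note Bs = bilin_add_left[OF B] bilin_scale_left[OF B] bilin_add_right[OF B] bilin_scale_right[OF B]
  have fp: "f p = b" "f p' = b"
    using M by (simp_all add: p_def p'_def f_add f_scale f_n Bs Bn f_e \<beta>)
  have Bp: "B p p' = 1" using M by (simp add: p_def p'_def Bs Bn B_e)
  let ?W = "extend (extend {0} p) p'"
  have f_eq: "f (x \<cdot> p + y \<cdot> p') = b * (x + y)\<^sup>2 + x * y" for x y
    by (simp add: f_add[of "x \<cdot> p"] f_scale fp Bs Bp square_add algebra_simps)
  have mem: "z \<in> ?W \<longleftrightarrow> (\<exists>x y. z = x \<cdot> p + y \<cdot> p')" for z
    by (auto simp: extend_def image_iff)
  have p0: "p \<notin> {0}"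
  proof
    assume "p \<in> {0}"
    then have "f p = 0" by simp
    then show False using fp(1) b(1) by simp
  qed
  have "p' \<notin> extend {0} p"
  proof
    assume "p' \<in> extend {0} p"
    then obtain w x where "p' = w + x \<cdot> p" "w \<in> {0}" by (rule extendE)
    then have "B p p' = x * B p p" by (simp add: Bs)
    then show False using Bp by simp
  qed
  then have cW: "card ?W = CARD('k) * (CARD('k) * 1)"
    using card_extend[OF subspace_extend[OF subspace_single_0], of p' p]
      card_extend[OF subspace_single_0 p0] by simp
  have sW: "subspace ?W" by (intro subspace_extend subspace_single_0)
  have "{w\<in>?W. f w = 0} = {0}"
  proof
    show "{w\<in>?W. f w = 0} \<subseteq> {0}"
    proof
      fix z assume z: "z \<in> {w\<in>?W. f w = 0}"
      then obtain x y where z_eq: "z = x \<cdot> p + y \<cdot> p'" using mem by auto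
      then have "b * (x + y)\<^sup>2 + x * y = 0" using z f_eq by simp
      then show "z \<in> {0}" using b(2)[of x y] z_eq by simp
    qed
    show "{0} \<subseteq> {w\<in>?W. f w = 0}" using subspace_0[OF sW] by simp
  qed
  then have "level ?W 0 = 1" by (simp add: level_def)
  then have "1 + (CARD('k) - 1) * level ?W a = CARD('k) * CARD('k)"
    using level_0_add[OF sW a] cW by simp
  moreover obtain Q where Q: "CARD('k) = Suc Q" "Q > 0"
    using card_field_ge2[where 'a='k] by (cases "CARD('k)") auto
  ultimately have "Q * level ?W a = Q * (Q + 2)" by simp
  then have "level ?W a = Q + 2" using Q(2) unfolding mult_cancel1 by blast
  then have "level ?W a = CARD('k) + 1" using Q(1) by simp
  moreover have "B w (e i) = 0 \<and> B w (e' i) = 0" if w: "w \<in> ?W" and i: "i \<in> {1<..M}" for w i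
  proof -
    obtain x y where w_eq: "w = x \<cdot> p + y \<cdot> p'" using mem w by auto
    show ?thesis using M i by (simp add: w_eq p_def p'_def Bs B_e B_e')
  qed
  ultimately show ?thesis using sW cW by (intro exI[of _ ?W]) (simp add: power2_eq_square)
qed

text \<open>\<open>k\<close> counts the hyperbolic pairs that have been used, and the orthogonality
  clause keeps the later pairs free. The excess \<open>q ^ (k - 1)\<close> grows by the factor
  \<open>q\<close> with each new pair, whether one vector of it is added or both; this choice
  adjusts the dimension \<open>s\<close>.\<close>

lemma exists_subspace_level:
  assumes a: "a \<noteq> 0"
  shows "1 \<le> k \<Longrightarrow> k \<le> M \<Longrightarrow> k + 1 \<le> s \<Longrightarrow> s \<le> 2 * k \<Longrightarrow>
    \<exists>W. subspace W \<and> card W = CARD('k) ^ s \<and> level W a = CARD('k) ^ (s - 1) + CARD('k) ^ (k - 1)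
    \<and> (\<forall>w\<in>W. \<forall>i\<in>{k<..M}. B w (e i) = 0 \<and> B w (e' i) = 0)"
proof (induction k arbitrary: s rule: nat_induct_at_least)
  case base
  then have "s = 2" by simp
  then show ?case using exists_elliptic_plane[OF a base(1)] by simp
next
  case (Suc k)
  \<comment> \<open>At the top dimension \<open>s = 2 * k + 2\<close>, the value
    \<open>s - 1\<close> would exceed the range \<open>s0 \<le> 2 * k\<close>, so both vectors of
    the new pair are added.\<close>
  define s0 where "s0 = (if s = 2 * k + 2 then s - 2 else s - 1)"
  have s0: "k + 1 \<le> s0" "s0 \<le> 2 * k" using Suc.prems Suc.hyps by (auto simp: s0_def)
  obtain W where W: "subspace W" "card W = CARD('k) ^ s0"
      "level W a = CARD('k) ^ (s0 - 1) + CARD('k) ^ (k - 1)"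
    and perp: "\<And>w i. w \<in> W \<Longrightarrow> i \<in> {k<..M} \<Longrightarrow> B w (e i) = 0 \<and> B w (e' i) = 0"
    using Suc.IH[OF _ s0] Suc.prems by auto
  define u where "u = e (Suc k)"
  define v where "v = e' (Suc k)"
  have kM: "Suc k \<in> {1..M}" "Suc k \<in> {k<..M}" using Suc.prems by auto
  have uv: "f u = 0" "f v = 0" "B u v = 1"
    using kM f_e B_e by (simp_all add: u_def v_def)
  have pu: "B w u = 0" and pv: "B w v = 0" if "w \<in> W" for w
    using perp[OF that kM(2)] by (simp_all add: u_def v_def)
  note Bs = bilin_add_left[OF B] bilin_scale_left[OF B] bilin_add_right[OF B] bilin_scale_right[OF B]
  have uW: "u \<notin> W" by (rule notin_if_dual_vector[OF pv uv(3)])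
  have perp1: "B z (e i) = 0 \<and> B z (e' i) = 0" if z: "z \<in> extend W u" and i: "i \<in> {Suc k<..M}" for z i
  proof -
    obtain w x where z_eq: "z = w + x \<cdot> u" and w: "w \<in> W" using z by (rule extendE)
    show ?thesis using perp[OF w, of i] i kM B_e by (simp add: z_eq u_def Bs)
  qed
  obtain s1 where s1: "s0 = Suc s1" using s0 by (cases s0) auto
  obtain k1 where k1: "k = Suc k1" using Suc.hyps by (cases k) auto
  show ?case
  proof (cases "s = 2 * k + 2")
    case True
    then have s: "s = s0 + 2" by (simp add: s0_def)
    have vu: "B v u = 1" using uv(3) bilin_sym[OF B] by metis
    have "B z u = 0" if z: "z \<in> extend W u" for z
    proof -
      obtain w x where "z = w + x \<cdot> u" "w \<in> W" using z by (rule extendE)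
      then show ?thesis using pu by (simp add: Bs)
    qed
    then have v: "v \<notin> extend W u" by (rule notin_if_dual_vector[OF _ vu])
    let ?W = "extend (extend W u) v"
    have "subspace ?W" by (intro subspace_extend W)
    moreover have "card ?W = CARD('k) ^ s"
      using card_extend[OF subspace_extend[OF W(1)] v] card_extend[OF W(1) uW] W(2) s by simp
    moreover have "level ?W a = CARD('k) ^ (s - 1) + CARD('k) ^ (Suc k - 1)"
    proof -
      obtain Q where Q: "CARD('k) = Suc Q"
        using card_field_ge2[where 'a='k] by (cases "CARD('k)") auto
      \<comment> \<open>The summand \<open>(q - 1) * q ^ s0\<close> lifts the main term from
        \<open>q ^ s0\<close> to \<open>q ^ (s0 + 1)\<close>, as two new dimensions require.\<close>
      have "level ?W a = CARD('k) * level W a + (CARD('k) - 1) * card W"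
        by (rule level_extend_hyperbolic[OF W(1) pu pv uv])
      then show ?thesis unfolding W(2,3) s s1 k1 Q by (simp add: algebra_simps)
    qed
    moreover have "B z (e i) = 0 \<and> B z (e' i) = 0" if z: "z \<in> ?W" and i: "i \<in> {Suc k<..M}" for z i
    proof -
      obtain w x where z_eq: "z = w + x \<cdot> v" and w: "w \<in> extend W u" using z by (rule extendE)
      show ?thesis using perp1[OF w i] i kM B_e B_e' by (simp add: z_eq v_def Bs)
    qed
    ultimately show ?thesis by blast
  next
    case False
    then have s: "s = s0 + 1" using Suc.prems by (simp add: s0_def)
    have "subspace (extend W u)" by (intro subspace_extend W)
    moreover have "card (extend W u) = CARD('k) ^ s"
      using card_extend[OF W(1) uW] W(2) s by simp
    moreover have "level (extend W u) a = CARD('k) ^ (s - 1) + CARD('k) ^ (Suc k - 1)"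
    proof -
      have "level (extend W u) a = CARD('k) * level W a"
        by (rule level_extend_isotropic[OF W(1) pu uW uv(1)])
      then show ?thesis unfolding W(3) s s1 k1 by (simp add: algebra_simps)
    qed
    ultimately show ?thesis using perp1 by blast
  qed
qed

end

context type_III_space
begin

text \<open>The value \<open>min M (s - 1)\<close> is the largest admissible \<open>k\<close> and
  also governs \<open>level_le\<close>, so that bound is attained.\<close>

lemma exists_subspace_level_eq:
  assumes a: "a \<noteq> 0" and s: "2 \<le> s" "s \<le> 2 * M"
  shows "\<exists>W. subspace W \<and> dim W = s \<and>
    level W a = CARD('k) ^ (s - 1) + CARD('k) ^ (min M (s - 1) - 1)"
proof -
  let ?k = "min M (s - 1)"
  have "1 \<le> ?k" "?k \<le> M" "?k + 1 \<le> s" "s \<le> 2 * ?k" using s by auto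
  from exists_subspace_level[OF a this] obtain W where "subspace W" "card W = CARD('k) ^ s"
    "level W a = CARD('k) ^ (s - 1) + CARD('k) ^ (?k - 1)" by blast
  then show ?thesis using dim_eq_if_card_eq by blast
qed

end

context odd_quadratic_space
begin

text \<open>The line of \<open>n\<close> is its own radical and \<open>f\<close> is nonzero at
  \<open>n\<close>, so its \<open>q\<close> elements are equidistributed over the \<open>q\<close>
  values.\<close>

lemma exists_line_level_eq:
  assumes a: "a \<noteq> 0"
  shows "\<exists>W. subspace W \<and> dim W = 1 \<and> level W a = 1"
proof -
  let ?W = "extend {0} n"
  have n0: "n \<notin> {0}"
  proof
    assume "n \<in> {0}"
    then have "f n = 0" by simp
    then show False using f_n by simp
  qed
  have W: "subspace ?W" by (intro subspace_extend subspace_single_0)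
  have c: "card ?W = CARD('k)" using card_extend[OF subspace_single_0 n0] by simp
  have "n \<in> ?W" using extendI[of 0 "{0}" 1 n] by simp
  then have "n \<in> rad ?W" by (simp add: rad_def perp_def)
  moreover have "f n \<noteq> 0" by (simp add: f_n)
  ultimately have "\<exists>y\<in>rad ?W. f y \<noteq> 0" by blast
  then have "CARD('k) * level ?W a = CARD('k)"
    using level_anisotropic_rad[OF W a] c by metis
  then have "level ?W a = 1" by simp
  moreover have "dim ?W = 1" by (rule dim_eq_if_card_eq[OF W]) (simp add: c)
  ultimately show ?thesis using W by blast
qed

end

section \<open>The trace form\<close>

text \<open>Translation by 1 permutes the field, so comparing sums gives
  \<open>of_nat CARD('a) = 0\<close>; for a power of 2 this forces 2 to vanish.\<close>

lemma one_add_one_eq_0_if_card: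
  assumes "CARD('a::{field,finite}) = 2 ^ e"
  shows "(1::'a) + 1 = 0"
proof -
  have "(\<Sum>x\<in>UNIV. x) = (\<Sum>x\<in>UNIV. x + (1::'a))"
    by (rule sum.reindex_bij_witness[of _ "\<lambda>x. x + 1" "\<lambda>x. x - 1"]) auto
  then have "of_nat CARD('a) = (0::'a)" by (simp add: sum.distrib)
  then have "(2::'a) ^ e = 0" unfolding assms by simp
  then have "(2::'a) = 0" by simp
  then show ?thesis by simp
qed

lemma power_card_eq_self: "(x::'a::{field,finite}) ^ CARD('a) = x"
proof (cases "x = 0")
  case False
  have "(\<Prod>y\<in>UNIV-{0}. x * y) = (\<Prod>y\<in>UNIV-{0}. y)"
    by (rule prod.reindex_bij_witness[of _ "\<lambda>y. y / x" "\<lambda>y. x * y"]) (use False in auto)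
  then have "x ^ (CARD('a) - 1) * (\<Prod>y\<in>UNIV-{0::'a}. y) = (\<Prod>y\<in>UNIV-{0::'a}. y)"
    by (simp add: prod.distrib card_Diff_singleton)
  then have "x ^ (CARD('a) - 1) = 1" by simp
  moreover have "CARD('a) = Suc (CARD('a) - 1)" by simp
  ultimately show ?thesis by (metis mult.right_neutral power_Suc)
qed simp

lemma add_power_2_power:
  assumes "(1::'a::comm_ring_1) + 1 = 0"
  shows "(x + y :: 'a) ^ 2 ^ j = x ^ 2 ^ j + y ^ 2 ^ j"
proof (induction j)
  case (Suc j)
  have sq: "(u + v)\<^sup>2 = u\<^sup>2 + v\<^sup>2" for u v :: 'a
  proof -
    have "(u + v)\<^sup>2 = u\<^sup>2 + v\<^sup>2 + (1 + 1) * (u * v)"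
      by (simp add: power2_eq_square algebra_simps)
    then show ?thesis using assms by simp
  qed
  have p: "u ^ 2 ^ Suc j = (u ^ 2 ^ j)\<^sup>2" for u :: 'a
    by (simp add: power_mult[symmetric] mult.commute)
  show ?case unfolding p Suc.IH sq ..
qed simp

locale finite_extension =
  fixes \<iota> :: "'k::{field,finite} \<Rightarrow> 'K::{field,finite}" and e m :: nat
  assumes emb: "field_embedding \<iota>" and card_k: "CARD('k) = 2 ^ e"
    and card_K: "CARD('K) = CARD('k) ^ m" and m_pos: "m > 0"
begin

lemma \<iota>_simps: "\<iota> 1 = 1" "\<iota> (x + y) = \<iota> x + \<iota> y" "\<iota> (x * y) = \<iota> x * \<iota> y"
  using emb unfolding field_embedding_def by blast+

lemma \<iota>_0: "\<iota> 0 = 0"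
  using \<iota>_simps(2)[of 0 1] by simp

lemma \<iota>_power: "\<iota> (x ^ i) = \<iota> x ^ i"
  by (induction i) (simp_all add: \<iota>_simps)

lemma inj_\<iota>: "inj \<iota>"
proof (rule injI)
  fix x y assume xy: "\<iota> x = \<iota> y"
  have "\<iota> (x - y) + \<iota> y = \<iota> x" using \<iota>_simps(2)[of "x - y" y] by simp
  then have 0: "\<iota> (x - y) = 0" using xy by simp
  show "x = y"
  proof (rule ccontr)
    assume "x \<noteq> y"
    then have "\<iota> ((x - y) * inverse (x - y)) = 1" using \<iota>_simps(1) by simp
    then show False unfolding \<iota>_simps(3) 0 by simp
  qed
qed

sublocale finite_vector_space "ext_scale \<iota>"
  using vector_space_ext_scale[OF emb] by (simp add: finite_vector_space_def)

lemma ext_degree_eq: "ext_degree \<iota> = m"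
  unfolding ext_degree_def by (rule dim_eq_if_card_eq) (simp_all add: card_K)

lemma power_card_power_eq_self: "(c::'k) ^ (CARD('k) ^ i) = c"
  by (induction i) (simp_all add: power_mult power_card_eq_self)

text \<open>The \<open>q\<close> embedded elements are roots of \<open>X^q - X\<close>, which has at
  most \<open>q\<close> roots.\<close>

lemma range_\<iota>: "range \<iota> = {x. x ^ CARD('k) = x}"
proof (rule card_subset_eq)
  show "range \<iota> \<subseteq> {x. x ^ CARD('k) = x}"
    by (auto simp: \<iota>_power[symmetric] power_card_eq_self)
  let ?p = "monom 1 CARD('k) - monom 1 1 :: 'K poly"
  have c: "CARD('k) \<noteq> 1" using card_field_ge2[where 'a='k] by simp
  then have "coeff ?p 1 = -1" by simp
  then have p0: "?p \<noteq> 0" by (metis coeff_0 neg_equal_0_iff_equal one_neq_zero)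
  have deg: "degree ?p \<le> CARD('k)"
    using card_field_ge2[where 'a='k] by (intro degree_diff_le) (simp_all add: degree_monom_eq)
  have "card {x::'K. x ^ CARD('k) = x} = card {x. poly ?p x = 0}"
    by (simp add: poly_monom)
  also have "\<dots> \<le> CARD('k)" using card_poly_roots_bound[OF p0] deg by simp
  finally have "card {x::'K. x ^ CARD('k) = x} \<le> card (range \<iota>)"
    by (simp add: card_image inj_\<iota>)
  moreover have "card (range \<iota>) \<le> card {x::'K. x ^ CARD('k) = x}"
    by (rule card_mono) (use \<open>range \<iota> \<subseteq> {x. x ^ CARD('k) = x}\<close> in auto)
  ultimately show "card (range \<iota>) = card {x::'K. x ^ CARD('k) = x}" by simp
qed simp

definition conj_sum :: "'K \<Rightarrow> 'K" where
  "conj_sum x = (\<Sum>i<m. x ^ (CARD('k) ^ i))"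

lemma add_power_card_power: "(x + y :: 'K) ^ (CARD('k) ^ i) = x ^ (CARD('k) ^ i) + y ^ (CARD('k) ^ i)"
proof -
  have "CARD('K) = 2 ^ (e * m)" by (simp add: card_K card_k power_mult)
  then have "(1::'K) + 1 = 0" by (rule one_add_one_eq_0_if_card)
  then show ?thesis unfolding card_k power_mult[symmetric] by (rule add_power_2_power)
qed

lemma conj_sum_add: "conj_sum (x + y) = conj_sum x + conj_sum y"
  by (simp add: conj_sum_def add_power_card_power sum.distrib)

lemma conj_sum_scale: "conj_sum (\<iota> c * x) = \<iota> c * conj_sum x"
  by (simp add: conj_sum_def power_mult_distrib \<iota>_power[symmetric] power_card_power_eq_self sum_distrib_left)

lemma sum_power_card: "(\<Sum>i\<in>I. g i :: 'K) ^ CARD('k) = (\<Sum>i\<in>I. g i ^ CARD('k))"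
  by (induction I rule: infinite_finite_induct)
    (use add_power_card_power[of _ _ 1] in \<open>simp_all add: zero_power\<close>)

text \<open>The \<open>q\<close>-th power shifts the conjugates cyclically, because
  \<open>x ^ (q ^ m) = x\<close>. So the sum is fixed by Frobenius, and \<open>inv \<iota>\<close>
  in the trace yields a genuine preimage.\<close>

lemma conj_sum_in_range: "conj_sum x \<in> range \<iota>"
proof -
  let ?h = "\<lambda>i. x ^ (CARD('k) ^ i)"
  have "conj_sum x ^ CARD('k) = (\<Sum>i<m. ?h (Suc i))"
    by (simp add: conj_sum_def sum_power_card power_mult[symmetric] mult.commute)
  also have "\<dots> + ?h 0 = (\<Sum>i<Suc m. ?h i)"
    by (simp only: sum.lessThan_Suc_shift add.commute)
  also have "\<dots> = conj_sum x + ?h m" by (simp add: conj_sum_def)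
  also have "?h m = ?h 0" using power_card_eq_self[of x] by (simp add: card_K)
  finally show ?thesis by (simp add: range_\<iota>)
qed

lemma \<iota>_trace: "\<iota> (field_trace \<iota> x) = conj_sum x"
  unfolding field_trace_def ext_degree_eq conj_sum_def[symmetric]
  by (rule f_inv_into_f[OF conj_sum_in_range])

lemma trace_add: "field_trace \<iota> (x + y) = field_trace \<iota> x + field_trace \<iota> y"
  by (rule injD[OF inj_\<iota>]) (simp only: \<iota>_trace \<iota>_simps(2) conj_sum_add)

lemma trace_scale: "field_trace \<iota> (\<iota> c * x) = c * field_trace \<iota> x"
  by (rule injD[OF inj_\<iota>]) (simp only: \<iota>_trace \<iota>_simps(3) conj_sum_scale)

text \<open>The polynomial of the trace has linear coefficient 1 and degree at most
  \<open>q ^ (m - 1)\<close>, so it has too few roots to vanish on all \<open>q ^ m\<close>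
  elements.\<close>

lemma trace_nonzero: "\<exists>x. field_trace \<iota> x \<noteq> 0"
proof -
  note q2 = card_field_ge2[where 'a='k]
  let ?p = "\<Sum>i<m. monom 1 (CARD('k) ^ i) :: 'K poly"
  have "coeff ?p 1 = (\<Sum>i<m. if i = 0 then 1 else 0)"
    unfolding coeff_sum by (rule sum.cong) (use q2 in auto)
  then have p0: "?p \<noteq> 0" using m_pos by auto
  have "degree ?p \<le> CARD('k) ^ (m - 1)"
  proof (rule degree_sum_le)
    fix i assume "i \<in> {..<m}"
    then have "CARD('k) ^ i \<le> CARD('k) ^ (m - 1)" using q2 by (intro power_increasing) auto
    then show "degree (monom (1::'K) (CARD('k) ^ i)) \<le> CARD('k) ^ (m - 1)"
      using degree_monom_le order_trans by blast
  qed simp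
  then have "card {x. poly ?p x = 0} \<le> CARD('k) ^ (m - 1)"
    using card_poly_roots_bound[OF p0] by simp
  also have "\<dots> < CARD('K)" unfolding card_K using q2 m_pos by (intro power_strict_increasing) auto
  finally have "{x. poly ?p x = 0} \<noteq> UNIV" by auto
  then obtain x where "poly ?p x \<noteq> 0" by auto
  then have "conj_sum x \<noteq> 0" by (simp add: conj_sum_def poly_sum poly_monom)
  then show ?thesis using \<iota>_trace[of x] \<iota>_0 by metis
qed

definition trace_form :: "'K \<Rightarrow> 'K \<Rightarrow> 'k" where
  "trace_form x y = field_trace \<iota> (x * y)"

lemma bilin_trace_form: "bilin trace_form"
  unfolding bilin_def trace_form_def ext_scale_def
  by (simp add: distrib_right trace_add mult.assoc trace_scale) (simp add: mult.commute)

lemma trace_form_nondegenerate: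
  assumes "y \<noteq> 0"
  shows "\<exists>v. trace_form v y \<noteq> 0"
proof -
  obtain z where "field_trace \<iota> z \<noteq> 0" using trace_nonzero by blast
  then have "trace_form (z / y) y \<noteq> 0" using assms by (simp add: trace_form_def)
  then show ?thesis by blast
qed

end

section \<open>Trace codes\<close>

lemma finite_vector_space_vec:
  "finite_vector_space ((*s) :: 'k::{field,finite} \<Rightarrow> 'k ^ 'n \<Rightarrow> 'k ^ 'n::finite)"
  by (simp add: finite_vector_space_def vec.vector_space_axioms)

lemmas vec_dim_eq_if_card_eq = finite_vector_space.dim_eq_if_card_eq[OF finite_vector_space_vec]

locale spanning_defining_set = finite_extension \<iota> e m
  for \<iota> :: "'k::{field,finite} \<Rightarrow> 'K::{field,finite}" and e m +
  fixes d :: "'n::finite \<Rightarrow> 'K"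
  assumes inj_d: "inj d"
    and spanning: "subspace W \<Longrightarrow> range d \<subseteq> W \<Longrightarrow> W = UNIV"
begin

definition codeword :: "'K \<Rightarrow> 'k ^ 'n" where
  "codeword x = (\<chi> i. field_trace \<iota> (x * d i))"

lemma codeword_add: "codeword (x + y) = codeword x + codeword y"
  by (simp add: codeword_def vec_eq_iff distrib_right trace_add)

lemma codeword_scale: "codeword (ext_scale \<iota> c x) = c *s codeword x"
  by (simp add: codeword_def vec_eq_iff ext_scale_def mult.assoc trace_scale)

lemma codeword_0: "codeword 0 = 0"
  using codeword_add[of 0 0] by simp

lemma codeword_nth: "codeword x $ i = trace_form (d i) x"
  by (simp add: codeword_def trace_form_def mult.commute)

text \<open>The difference \<open>x - y\<close> is trace-orthogonal to the defining set, hence to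
  everything by \<open>spanning\<close>, and the trace form is nondegenerate.\<close>

lemma inj_codeword: "inj codeword"
proof (rule injI)
  fix x y assume xy: "codeword x = codeword y"
  have "codeword (x - y) + codeword y = codeword x" using codeword_add[of "x - y" y] by simp
  then have 0: "codeword (x - y) = 0" using xy by simp
  have "trace_form (d i) (x - y) = 0" for i
    using 0 codeword_nth[of "x - y" i] by simp
  then have "range d \<subseteq> perp trace_form {x - y}" by (auto simp: perp_def)
  then have "perp trace_form {x - y} = UNIV"
    by (rule spanning[OF subspace_perp[OF bilin_trace_form]])
  then have "trace_form v (x - y) = 0" for v by (auto simp: perp_def)
  then have "x - y = 0" using trace_form_nondegenerate[of "x - y"] by blast
  then show "x = y" by simp
qed

lemma trace_code_eq: "trace_code \<iota> d = range codeword"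
  by (simp add: trace_code_def codeword_def)

lemma subspace_codeword_image:
  assumes X: "subspace X"
  shows "vec.subspace (codeword ` X)"
proof (rule vec.subspaceI)
  show "0 \<in> codeword ` X" using codeword_0 subspace_0[OF X] by (metis image_eqI)
next
  fix u v assume "u \<in> codeword ` X" "v \<in> codeword ` X"
  then show "u + v \<in> codeword ` X"
    using subspace_add[OF X] by (auto simp: codeword_add[symmetric])
next
  fix c u assume "u \<in> codeword ` X"
  then show "c *s u \<in> codeword ` X"
    using subspace_scale[OF X] by (auto simp: codeword_scale[symmetric])
qed

lemma subspace_codeword_vimage:
  assumes H: "vec.subspace H"
  shows "subspace (codeword -` H)"
  by (rule subspaceI)
    (use vec.subspace_0[OF H] vec.subspace_add[OF H] vec.subspace_scale[OF H]
      in \<open>simp_all add: codeword_0 codeword_add codeword_scale\<close>)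

lemma dim_codeword_image:
  assumes X: "subspace X"
  shows "vec.dim (codeword ` X) = dim X"
proof (rule vec_dim_eq_if_card_eq[OF subspace_codeword_image[OF X]])
  show "card (codeword ` X) = CARD('k) ^ dim X"
    using card_subspace[OF X] card_image[of codeword X] inj_on_subset[OF inj_codeword] by simp
qed

lemma trace_code_subspace: "vec.subspace (trace_code \<iota> d)" "vec.dim (trace_code \<iota> d) = m"
proof -
  show "vec.subspace (trace_code \<iota> d)"
    unfolding trace_code_eq by (rule subspace_codeword_image) simp
  show "vec.dim (trace_code \<iota> d) = m"
    unfolding trace_code_eq using dim_codeword_image[OF subspace_UNIV] ext_degree_eq
    by (simp add: ext_degree_def)
qed

text \<open>A coordinate \<open>i\<close> is outside the support exactly when \<open>d i\<close> is
  trace-orthogonal to \<open>X\<close>, and \<open>d\<close> is injective.\<close>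

lemma card_code_supp:
  "card (code_supp (codeword ` X)) = CARD('n) - card (perp trace_form X \<inter> range d)"
proof -
  have "code_supp (codeword ` X) = - (d -` perp trace_form X)"
    by (auto simp: code_supp_def codeword_nth perp_def)
  moreover have "card (d -` perp trace_form X) = card (perp trace_form X \<inter> range d)"
    unfolding image_vimage_eq[symmetric] by (rule card_image[symmetric]) (rule inj_on_subset[OF inj_d subset_UNIV])
  ultimately show ?thesis by (simp add: Compl_eq_Diff_UNIV card_Diff_subset)
qed

lemma dim_perp_trace_form:
  assumes X: "subspace X"
  shows "dim X + dim (perp trace_form X) = m"
proof -
  have "card X * card (perp trace_form X) = CARD('K)"
    by (rule card_perp[OF bilin_trace_form X]) (rule trace_form_nondegenerate)
  then have "CARD('k) ^ (dim X + dim (perp trace_form X)) = CARD('k) ^ m"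
    by (simp add: card_K card_subspace X subspace_perp bilin_trace_form power_add)
  then show ?thesis using card_field_ge2[where 'a='k] by (simp add: power_inject_exp)
qed

text \<open>The \<open>r\<close>-dimensional subcodes are the images of the trace-orthogonal complements
  of the subspaces of codimension \<open>r\<close>.\<close>

lemma gen_hamming_weight_trace_code:
  assumes r: "r \<le> m" and W: "subspace W" "dim W = m - r" "card (W \<inter> range d) = N"
    and max: "\<And>V. subspace V \<Longrightarrow> dim V = m - r \<Longrightarrow> card (V \<inter> range d) \<le> N"
  shows "gen_hamming_weight r (trace_code \<iota> d) = CARD('n) - N"
  unfolding gen_hamming_weight_def
proof (rule Min_eqI)
  let ?S = "{card (code_supp H) |H. vec.subspace H \<and> H \<subseteq> trace_code \<iota> d \<and> vec.dim H = r}"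
  show "finite ?S"
    by (rule finite_subset[of _ "(\<lambda>H. card (code_supp H)) ` UNIV"]) auto
  show "CARD('n) - N \<le> y" if y: "y \<in> ?S" for y
  proof -
    obtain H where H: "vec.subspace H" "H \<subseteq> range codeword" "vec.dim H = r" and y_eq: "y = card (code_supp H)"
      using y unfolding trace_code_eq by blast
    define X where "X = codeword -` H"
    have X: "subspace X" unfolding X_def by (rule subspace_codeword_vimage[OF H(1)])
    have HX: "H = codeword ` X" using H(2) by (auto simp: X_def)
    have "dim X = r" using dim_codeword_image[OF X] H(3) HX by simp
    then have "dim (perp trace_form X) = m - r" using dim_perp_trace_form[OF X] by simp
    then have "card (perp trace_form X \<inter> range d) \<le> N"
      by (rule max[OF subspace_perp[OF bilin_trace_form]])
    then show ?thesis unfolding y_eq HX card_code_supp by simp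
  qed
  \<comment> \<open>The minimum is attained at the complement of the extremal \<open>W\<close>,
    whose complement is \<open>W\<close> again.\<close>
  let ?X = "perp trace_form W"
  have X: "subspace ?X" by (rule subspace_perp[OF bilin_trace_form])
  have "perp trace_form ?X = W"
    by (rule perp_perp[OF bilin_trace_form W(1)]) (rule trace_form_nondegenerate)
  then have "CARD('n) - N = card (code_supp (codeword ` ?X))"
    using card_code_supp[of ?X] W(3) by simp
  moreover have "vec.dim (codeword ` ?X) = r"
    using dim_codeword_image[OF X] dim_perp_trace_form[OF W(1)] W(2) r by simp
  ultimately show "CARD('n) - N \<in> ?S"
    using subspace_codeword_image[OF X] unfolding trace_code_eq by blast
qed

end

section \<open>From the Type III normal form to hyperbolic pairs\<close>

lemma type_III_form_add:
  fixes x y :: "nat \<Rightarrow> 'k::field"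
  assumes two: "(1::'k) + 1 = 0"
  shows "type_III_form t (\<lambda>i. x i + y i) = type_III_form t x + type_III_form t y +
    (\<Sum>i = 1..(t - 1) div 2. x (2 * i - 1) * y (2 * i) + x (2 * i) * y (2 * i - 1))"
proof -
  \<comment> \<open>With 2 = 0 squaring is additive, so the last coordinate contributes nothing to
    the polar form.\<close>
  have "(2::'k) = 0" using two by simp
  then have "(x t + y t)\<^sup>2 = (x t)\<^sup>2 + (y t)\<^sup>2" by (simp add: power2_sum)
  then show ?thesis
    by (simp add: type_III_form_def algebra_simps sum.distrib)
qed

lemma type_III_form_scale: "type_III_form t (\<lambda>i. c * x i) = c\<^sup>2 * type_III_form t x"
  by (simp add: type_III_form_def power_mult_distrib power2_eq_square algebra_simps sum_distrib_left)

text \<open>\<open>L\<close> carries the given basis to one in which \<open>f\<close> has its normal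
  form. Consecutive odd and even indices give the hyperbolic pairs, and the last index gives
  \<open>n\<close>.\<close>

lemma (in finite_extension) type_III_space_exists:
  assumes m: "m = 2 * M + 1" and basis: "is_ext_basis \<iota> m \<epsilon>"
    and nd: "qf_nondegenerate f" and III: "qf_type_III \<iota> m \<epsilon> f"
  shows "\<exists>B n p p'. type_III_space (ext_scale \<iota>) f B M n p p'"
proof -
  define c where "c = ext_coord \<iota> m \<epsilon>"
  have ind: "independent (\<epsilon> ` {1..m})" and inj: "inj_on \<epsilon> {1..m}"
    using basis unfolding is_ext_basis_def by auto
  have sp: "x \<in> span (\<epsilon> ` {1..m})" for x
    using basis unfolding is_ext_basis_def by simp
  have c_add: "c (x + y) i = c x i + c y i" for x y i
    unfolding c_def ext_coord_def by (simp only: representation_add[OF ind sp sp])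
  have c_scale: "c (ext_scale \<iota> b x) i = b * c x i" for b x i
    unfolding c_def ext_coord_def by (simp only: representation_scale[OF ind sp])
  have c_basis: "c (\<epsilon> j) i = (if i = j then 1 else 0)" if "i \<in> {1..m}" "j \<in> {1..m}" for i j
    unfolding c_def ext_coord_def using that inj
    by (simp only: representation_basis[OF ind imageI] inj_on_eq_iff)
  \<comment> \<open>The kernel is trivial, so the rank is \<open>m\<close> and the normal form
    involves all coordinates.\<close>
  have "dim {0} = 0" by (rule dim_eq_if_card_eq[OF subspace_single_0]) simp
  then have rank: "qf_rank \<iota> m f = m"
    using nd unfolding qf_rank_def qf_nondegenerate_def by simp
  obtain L where L: "Vector_Spaces.linear (ext_scale \<iota>) (ext_scale \<iota>) L" "bij L"
    and fL: "\<And>x. f (L x) = type_III_form m (c x)"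
    using III unfolding qf_type_III_def rank c_def by blast
  \<comment> \<open>\<open>h x\<close> lists the coordinates of \<open>x\<close> in the basis
    \<open>L (\<epsilon> j)\<close>.\<close>
  define h where "h x = c (inv L x)" for x
  have Linv: "L (inv L x) = x" for x using L(2) by (simp add: bij_is_surj surj_f_inv_f)
  have invL: "inv L (L x) = x" for x using L(2) by (simp add: bij_is_inj)
  have L_add: "L (x + y) = L x + L y" for x y
    using L(1) by (simp add: Vector_Spaces.linear_iff)
  have L_scale: "L (ext_scale \<iota> b x) = ext_scale \<iota> b (L x)" for b x
    using L(1) by (simp add: Vector_Spaces.linear_iff)
  have h_add: "h (x + y) = (\<lambda>i. h x i + h y i)" for x y
  proof
    fix i
    have "inv L (x + y) = inv L x + inv L y" using L_add Linv invL by metis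
    then show "h (x + y) i = h x i + h y i" by (simp add: h_def c_add)
  qed
  have h_scale: "h (ext_scale \<iota> b x) = (\<lambda>i. b * h x i)" for b x
  proof
    fix i
    have "inv L (ext_scale \<iota> b x) = ext_scale \<iota> b (inv L x)" using L_scale Linv invL by metis
    then show "h (ext_scale \<iota> b x) i = b * h x i" by (simp add: h_def c_scale)
  qed
  have f_eq: "f x = type_III_form m (h x)" for x
    using fL[of "inv L x"] by (simp add: Linv h_def)
  \<comment> \<open>The polar form as it appears in \<open>type_III_form_add\<close>. Coordinate
    \<open>m\<close> is absent, which puts \<open>L (\<epsilon> m)\<close> into the radical.\<close>
  define B where "B x y = (\<Sum>i = 1..M. h x (2 * i - 1) * h y (2 * i) + h x (2 * i) * h y (2 * i - 1))" for x y
  have hL: "h (L (\<epsilon> j)) i = (if i = j then 1 else 0)" if "i \<in> {1..m}" "j \<in> {1..m}" for i j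
    using c_basis[OF that] by (simp add: h_def invL)
  have two: "(1::'k) + 1 = 0" by (rule one_add_one_eq_0_if_card[OF card_k])
  have f_add: "f (x + y) = f x + f y + B x y" for x y
    unfolding f_eq h_add type_III_form_add[OF two] B_def m by simp
  have f_scale: "f (ext_scale \<iota> b x) = b\<^sup>2 * f x" for b x
    unfolding f_eq h_scale type_III_form_scale ..
  have bil: "bilin B"
    unfolding bilin_def B_def h_add h_scale
    by (auto simp: algebra_simps sum.distrib sum_distrib_left)
  have nondeg: "x = 0" if "f x = 0" "\<And>y. B x y = 0" for x
  proof -
    have "x \<in> qf_ker f" using that by (simp add: qf_ker_def f_add)
    then show ?thesis using nd by (simp add: qf_nondegenerate_def)
  qed
  define n where "n = L (\<epsilon> m)"
  define p where "p i = L (\<epsilon> (2 * i - 1))" for i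
  define p' where "p' i = L (\<epsilon> (2 * i))" for i
  have f_type: "f x = (\<Sum>i = 1..M. h x (2 * i - 1) * h x (2 * i)) + (h x m)\<^sup>2" for x
    unfolding f_eq type_III_form_def m by simp
  have hn: "h n i = (if i = m then 1 else 0)" if "i \<in> {1..m}" for i
    unfolding n_def by (rule hL) (use that m in auto)
  have hp: "h (p j) i = (if i = 2 * j - 1 then 1 else 0)"
    and hp': "h (p' j) i = (if i = 2 * j then 1 else 0)" if "i \<in> {1..m}" "j \<in> {1..M}" for i j
    unfolding p_def p'_def by (rule hL; use that m in auto)+
  have idx: "2 * i - 1 \<in> {1..m}" "2 * i \<in> {1..m}" "2 * i - 1 \<noteq> m" "2 * i \<noteq> m" "m \<in> {1..m}"
    if "i \<in> {1..M}" for i using that m by auto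
  have par: "2 * i - 1 \<noteq> 2 * j" "2 * j \<noteq> 2 * i - 1" "2 * i - 1 = 2 * j - 1 \<longleftrightarrow> i = j"
    if "i \<in> {1..M}" "j \<in> {1..M}" for i j :: nat using that by (auto, presburger+)
  have m1: "m \<in> {1..m}" using m by simp
  have B_n: "B n y = 0" for y
    unfolding B_def by (rule sum.neutral) (use hn idx in simp)
  have f_n: "f n = 1"
  proof -
    have "(\<Sum>i = 1..M. h n (2 * i - 1) * h n (2 * i)) = 0"
      by (rule sum.neutral) (use hn idx in simp)
    then show ?thesis unfolding f_type using hn[OF m1] by simp
  qed
  have f_p: "f (p i) = 0" "f (p' i) = 0" if i: "i \<in> {1..M}" for i
  proof -
    have "(\<Sum>j = 1..M. h (p i) (2 * j - 1) * h (p i) (2 * j)) = 0"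
      "(\<Sum>j = 1..M. h (p' i) (2 * j - 1) * h (p' i) (2 * j)) = 0"
      by (rule sum.neutral; use hp hp' idx par i in simp)+
    moreover have "h (p i) m = 0" "h (p' i) m = 0"
      using hp[OF m1 i] hp'[OF m1 i] idx[OF i] by simp_all
    ultimately show "f (p i) = 0" "f (p' i) = 0" unfolding f_type by simp_all
  qed
  have B_p: "B (p i) (p j) = 0" "B (p' i) (p' j) = 0" "B (p i) (p' j) = (if i = j then 1 else 0)"
    if i: "i \<in> {1..M}" and j: "j \<in> {1..M}" for i j
  proof -
    show "B (p i) (p j) = 0" "B (p' i) (p' j) = 0" unfolding B_def
      by (rule sum.neutral; use hp hp' idx par i j in simp)+
    have "B (p i) (p' j) = (\<Sum>l = 1..M. if l = i \<and> l = j then 1 else 0)" unfolding B_def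
      by (rule sum.cong) (use hp hp' idx par i j in auto)
    also have "\<dots> = (\<Sum>l = 1..M. if l = i then (if i = j then 1 else 0) else 0)"
      by (rule sum.cong) auto
    also have "\<dots> = (if i = j then 1 else 0)" using i by simp
    finally show "B (p i) (p' j) = (if i = j then 1 else 0)" .
  qed
  have "type_III_space (ext_scale \<iota>) f B M n p p'"
    by (intro_locales; unfold_locales)
      (fact two f_add f_scale bil nondeg f_n B_n f_p B_p | simp add: card_K m)+
  then show ?thesis by blast
qed

section \<open>The weight hierarchy, from the largest level in each dimension\<close>

theorem theorem3:
  fixes \<iota> :: "'k::{field,finite} \<Rightarrow> 'K::{field,finite}"
    and q m e :: nat
    and \<epsilon> :: "nat \<Rightarrow> 'K"
    and f :: "'K \<Rightarrow> 'k"
    and a :: 'k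
    and d :: "'n::finite \<Rightarrow> 'K"
  assumes "q = 2 ^ e" and "CARD('k) = q"
    and "odd m" and "CARD('K) = q ^ m"
    and "field_embedding \<iota>"
    and "is_ext_basis \<iota> m \<epsilon>"
    and "a \<noteq> 0"
    and "quadratic_form \<iota> m \<epsilon> f"
    and "qf_nondegenerate f"
    and "qf_type_III \<iota> m \<epsilon> f"
    and "bij_betw d UNIV {x. f x = a}"
  shows "vec.subspace (trace_code \<iota> d) \<and>
    vec.dim (trace_code \<iota> d) = m \<and>
    (\<forall>r\<in>{1..m}.
      (1 \<le> r \<and> r \<le> (m - 1) div 2 \<longrightarrow>
        int (gen_hamming_weight r (trace_code \<iota> d)) =
          int q ^ (m - 1) - int q ^ (m - r - 1) - int q ^ ((m - 3) div 2)) \<and>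
      ((m + 1) div 2 \<le> r \<and> r < m - 1 \<longrightarrow>
        int (gen_hamming_weight r (trace_code \<iota> d)) =
          int q ^ (m - 1) - int q ^ (m - r - 1) - int q ^ (m - r - 2)) \<and>
      (r = m - 1 \<longrightarrow>
        int (gen_hamming_weight r (trace_code \<iota> d)) = int q ^ (m - 1) - 1) \<and>
      (r = m \<longrightarrow>
        int (gen_hamming_weight r (trace_code \<iota> d)) = int q ^ (m - 1)))"
proof -
  define M where "M = (m - 1) div 2"
  have m: "m = 2 * M + 1" using \<open>odd m\<close> by (auto simp: M_def elim: oddE)
  interpret finite_extension \<iota> e m
    using assms(1,2,4,5) m by unfold_locales auto
  obtain B n p p' where "type_III_space (ext_scale \<iota>) f B M n p p'"
    using type_III_space_exists[OF m assms(6,9,10)] by blast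
  then interpret T: type_III_space "ext_scale \<iota>" f B M n p p' .
  have inj: "inj d" and ran: "range d = {x. f x = a}"
    using assms(11) by (simp_all add: bij_betw_def)
  have level_eq: "T.level W a = card (W \<inter> range d)" for W
    unfolding T.level_def ran by (rule arg_cong[where f=card]) auto
  have card_n: "CARD('n) = q ^ (2 * M)"
    using T.level_UNIV[OF \<open>a \<noteq> 0\<close>] level_eq[of UNIV] card_image[OF inj] assms(2) by simp
  \<comment> \<open>A subspace containing the defining set has the level size of the whole space,
    which \<open>level_proper_less\<close> excludes for proper subspaces.\<close>
  have "W = UNIV" if W: "subspace W" "range d \<subseteq> W" for W
  proof (rule ccontr)
    assume "W \<noteq> UNIV"
    then have "T.level W a < q ^ (2 * M)"
      using T.level_proper_less[OF W(1) \<open>a \<noteq> 0\<close>] assms(2) by simp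
    moreover have "T.level W a = q ^ (2 * M)"
      using level_eq[of W] W(2) card_image[OF inj] card_n by (simp add: Int_absorb1)
    ultimately show False by simp
  qed
  then interpret C: spanning_defining_set \<iota> e m d
    using inj by unfold_locales auto
  \<comment> \<open>\<open>N\<close> is the largest level in dimension \<open>m - r\<close>. The
    bound \<open>N \<le> CARD('n)\<close> makes the subtraction of naturals agree with that of
    integers.\<close>
  have ghw: "int (gen_hamming_weight r (trace_code \<iota> d)) = int q ^ (m - 1) - int N"
    if r: "r \<in> {1..m}"
      and ex: "\<exists>W. subspace W \<and> dim W = m - r \<and> T.level W a = N"
      and max: "\<And>V. subspace V \<Longrightarrow> dim V = m - r \<Longrightarrow> T.level V a \<le> N" for r N
  proof -
    obtain W where W: "subspace W" "dim W = m - r" "card (W \<inter> range d) = N"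
      using ex level_eq by auto
    have "N \<le> CARD('n)"
      using card_mono[of "range d" "W \<inter> range d"] W(3) card_image[OF inj] by simp
    moreover have "gen_hamming_weight r (trace_code \<iota> d) = CARD('n) - N"
      by (rule C.gen_hamming_weight_trace_code[OF _ W]) (use r max level_eq in auto)
    ultimately show ?thesis using m by (simp add: of_nat_diff card_n)
  qed
  \<comment> \<open>For \<open>m - r \<ge> 2\<close> the bound \<open>level_le\<close> is attained;
    the first two cases of the formula differ only in the argument that the minimum selects.\<close>
  have mid: "int (gen_hamming_weight r (trace_code \<iota> d)) =
      int q ^ (m - 1) - int q ^ (m - r - 1) - int q ^ (min M (m - r - 1) - 1)"
    if r: "r \<in> {1..m}" "r + 2 \<le> m" for r
  proof -
    have s: "2 \<le> m - r" "m - r \<le> 2 * M" using r m by auto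
    have "int (gen_hamming_weight r (trace_code \<iota> d)) = int q ^ (m - 1)
        - int (q ^ (m - r - 1) + q ^ (min M (m - r - 1) - 1))"
    proof (rule ghw[OF r(1)])
      show "\<exists>W. subspace W \<and> dim W = m - r \<and>
          T.level W a = q ^ (m - r - 1) + q ^ (min M (m - r - 1) - 1)"
        using T.exists_subspace_level_eq[OF \<open>a \<noteq> 0\<close> s] unfolding assms(2) .
      show "T.level V a \<le> q ^ (m - r - 1) + q ^ (min M (m - r - 1) - 1)"
        if V: "subspace V" "dim V = m - r" for V
        using T.level_le[OF V(1) \<open>a \<noteq> 0\<close>] s(1) unfolding assms(2) V(2) by blast
    qed
    then show ?thesis by simp
  qed
  show ?thesis
  proof (intro conjI ballI impI)
    show "vec.subspace (trace_code \<iota> d)" "vec.dim (trace_code \<iota> d) = m"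
      by (rule C.trace_code_subspace)+
  next
    fix r assume r: "r \<in> {1..m}" "1 \<le> r \<and> r \<le> (m - 1) div 2"
    \<comment> \<open>Here \<open>m - r - 1 = 2 * M - r \<ge> M\<close>, so the minimum is
      \<open>M\<close>, and \<open>M - 1 = (m - 3) div 2\<close>.\<close>
    have "min M (m - r - 1) - 1 = (m - 3) div 2" "r + 2 \<le> m" using r m by auto
    then show "int (gen_hamming_weight r (trace_code \<iota> d)) =
        int q ^ (m - 1) - int q ^ (m - r - 1) - int q ^ ((m - 3) div 2)"
      using mid[OF r(1)] by simp
  next
    fix r assume r: "r \<in> {1..m}" "(m + 1) div 2 \<le> r \<and> r < m - 1"
    \<comment> \<open>Here \<open>r \<ge> M + 1\<close>, so \<open>m - r - 1 < M\<close> and the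
      minimum is \<open>m - r - 1\<close>.\<close>
    have "min M (m - r - 1) - 1 = m - r - 2" "r + 2 \<le> m" using r m by auto
    then show "int (gen_hamming_weight r (trace_code \<iota> d)) =
        int q ^ (m - 1) - int q ^ (m - r - 1) - int q ^ (m - r - 2)"
      using mid[OF r(1)] by simp
  next
    fix r assume r: "r \<in> {1..m}" "r = m - 1"
    \<comment> \<open>The complements are lines, and the best of them meets the defining set
      once.\<close>
    have mr: "m - r = 1" using r by auto
    have "int (gen_hamming_weight r (trace_code \<iota> d)) = int q ^ (m - 1) - int 1"
      by (rule ghw[OF r(1)]; unfold mr)
        (use T.exists_line_level_eq T.level_line_le \<open>a \<noteq> 0\<close> in blast)+
    then show "int (gen_hamming_weight r (trace_code \<iota> d)) = int q ^ (m - 1) - 1" by simp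
  next
    fix r assume r: "r \<in> {1..m}" "r = m"
    have mr: "m - r = 0" using r by auto
    have "subspace {0}" by simp
    moreover from this have "dim {0} = 0" by (rule dim_eq_if_card_eq) simp
    ultimately have "\<exists>W. subspace W \<and> dim W = 0 \<and> T.level W a = 0"
      using T.level_trivial[OF _ \<open>a \<noteq> 0\<close>] by blast
    then have "int (gen_hamming_weight r (trace_code \<iota> d)) = int q ^ (m - 1) - int 0"
      by (intro ghw[OF r(1)]; unfold mr) (use T.level_trivial[OF _ \<open>a \<noteq> 0\<close>] in auto)
    then show "int (gen_hamming_weight r (trace_code \<iota> d)) = int q ^ (m - 1)" by simp
  qed
qed

end
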